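(* Let $f(t,\eta)=\psi(t,\eta)e^{\mathrm{j}\theta(t,\eta)}$ be a random signal in $L^2(\mathbb{R}\times\Omega)$ with $\|f\|_{L^2(\mathbb{R}\times\Omega)}=1$. Suppose that for almost every $\eta\in\Omega$: $f(\cdot,\eta)$, $t f(t,\eta)$ and $\partial_t f(t,\eta)$ (as functions of $t$) belong to $L^2(\mathbb{R})$; $\psi(\cdot,\eta)$ and $\theta(\cdot,\eta)$ are continuously differentiable; and $\lim_{|t|\to\infty} f(t,\eta)=0$. Let $\alpha\in\mathbb{R}$ with $\sin\alpha\ne0$ and let $F_\alpha(\rho,\eta)$ be the fractional Fourier transform of $f$ with rotation parameter $\alpha$. Then $$\mathbb{E}_\eta[\sigma_t^2(\eta)]\;\mathbb{E}_\eta[\sigma_\rho^2(\eta)]\;\ge\;\frac{\sin^2\alpha}{4}+\left[\int_\Omega\int_{-\infty}^{+\infty}\left|(t-\mu_t)\left(t\cos\alpha+\sin\alpha\,\partial_t\theta(t,\eta)-\mu_\rho\right)\right|\psi^2(t,\eta)\,dt\,dP\right]^2,$$ where $$\mathbb{E}_\eta[\sigma_t^2(\eta)]=\int_\Omega\int_{-\infty}^{+\infty}(t-\mu_t)^2|f(t,\eta)|^2\,dt\,dP,\qquad \mathbb{E}_\eta[\sigma_\rho^2(\eta)]=\int_\Omega\int_{-\infty}^{+\infty}(\rho-\mu_\rho)^2|F_\alpha(\rho,\eta)|^2\,d\rho\,dP.$$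
   Context: $(\Omega,\mathcal{F},P)$ is a probability space and $\mathrm{j}$ is the imaginary unit. A random signal is a function $f(t,\eta)=\psi(t,\eta)e^{\mathrm{j}\theta(t,\eta)}$, $t\in\mathbb{R}$, $\eta\in\Omega$, with real-valued amplitude $\psi$ and real-valued phase $\theta$. Its norm is $\|f\|_{L^2(\mathbb{R}\times\Omega)}^2=\int_\Omega\int_{\mathbb{R}}|f(t,\eta)|^2\,dt\,dP$. The fractional Fourier transform (FrFT) of $f$ is, for $\sin\alpha\neq0$, $$F_\alpha(\rho,\eta)=\frac{1}{\sqrt{\mathrm{j}2\pi\sin\alpha}}\int_{-\infty}^{+\infty}f(t,\eta)\,e^{\mathrm{j}\frac{(t^2+\rho^2)\cos\alpha-2t\rho}{2\sin\alpha}}\,dt .$$ The means are $\mu_t=\int_\Omega\int_{-\infty}^{+\infty}t|f(t,\eta)|^2\,dt\,dP$ and $\mu_\rho=\int_\Omega\int_{-\infty}^{+\infty}\rho|F_\alpha(\rho,\eta)|^2\,d\rho\,dP$; they are understood to be given by absolutely convergent integrals. *)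

theory Defs
  imports "HOL-Probability.Probability"
begin

definition square_integrable :: "'a measure \<Rightarrow> ('a \<Rightarrow> complex) \<Rightarrow> bool" where
  "square_integrable M g \<longleftrightarrow>
     g \<in> borel_measurable M \<and> integrable M (\<lambda>x. (cmod (g x))\<^sup>2)"

definition signal_norm :: "'a measure \<Rightarrow> (real \<Rightarrow> 'a \<Rightarrow> complex) \<Rightarrow> real" where
  "signal_norm M f = sqrt (\<integral>\<eta>. (\<integral>t. (cmod (f t \<eta>))\<^sup>2 \<partial>lborel) \<partial>M)"

text \<open>The root in the prefactor is the principal branch. For a signal with \<open>f\<close> and \<open>t f\<close> in
  \<open>L\<^sup>2\<close> in the time variable, \<open>f\<close> is absolutely integrable, so the transform is
  an ordinary Lebesgue integral for every \<open>\<rho>\<close>.\<close>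

definition frft :: "real \<Rightarrow> (real \<Rightarrow> 'a \<Rightarrow> complex) \<Rightarrow> real \<Rightarrow> 'a \<Rightarrow> complex" where
  "frft \<alpha> f \<rho> \<eta> =
     1 / csqrt (\<i> * complex_of_real (2 * pi * sin \<alpha>)) *
     (\<integral>t. f t \<eta> * exp (\<i> * complex_of_real
        (((t\<^sup>2 + \<rho>\<^sup>2) * cos \<alpha> - 2 * t * \<rho>) / (2 * sin \<alpha>))) \<partial>lborel)"

text \<open>The double integral defining \<open>signal_mean\<close> below converges absolutely.\<close>

definition has_mean :: "'a measure \<Rightarrow> (real \<Rightarrow> 'a \<Rightarrow> complex) \<Rightarrow> bool" where
  "has_mean M g \<longleftrightarrow> integrable (lborel \<Otimes>\<^sub>M M) (\<lambda>(x, \<eta>). x * (cmod (g x \<eta>))\<^sup>2)"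

definition signal_mean :: "'a measure \<Rightarrow> (real \<Rightarrow> 'a \<Rightarrow> complex) \<Rightarrow> real" where
  "signal_mean M g = (\<integral>\<eta>. (\<integral>x. x * (cmod (g x \<eta>))\<^sup>2 \<partial>lborel) \<partial>M)"

text \<open>The expected spread about the mean may be infinite, hence the extended nonnegative value.\<close>

definition expected_spread :: "'a measure \<Rightarrow> (real \<Rightarrow> 'a \<Rightarrow> complex) \<Rightarrow> ennreal" where
  "expected_spread M g =
     (\<integral>\<^sup>+\<eta>. (\<integral>\<^sup>+x. ennreal ((x - signal_mean M g)\<^sup>2 * (cmod (g x \<eta>))\<^sup>2) \<partial>lborel) \<partial>M)"

end

theory Submission
  imports Defs
begin

text \<open>
  Fix \<open>\<mu>\<close> and \<open>\<nu>\<close>, the two means, and put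
  \<open>h = sin \<alpha> \<partial>\<^sub>t f + \<i> (t cos \<alpha> - \<nu>) f\<close>. Up to a factor of modulus one, \<open>h\<close> is \<open>sin \<alpha>\<close> times
  the derivative of \<open>f\<close> multiplied by a chirp, and the fractional Fourier transform is a rescaled
  Fourier transform of that product. Plancherel's theorem therefore bounds the expected spread of the
  transform below by the energy of \<open>h\<close> on \<open>\<real> \<times> \<Omega>\<close> (\<open>frft_second_moment_ge\<close>). For a signal
  \<open>f = \<psi> e\<^sup>\<i>\<^sup>\<theta>\<close>, the real and imaginary parts of \<open>cnj f h\<close> are \<open>sin \<alpha> \<psi> \<partial>\<^sub>t\<psi>\<close> and
  \<open>(t cos \<alpha> + sin \<alpha> \<partial>\<^sub>t\<theta> - \<nu>) \<psi>\<^sup>2\<close>. Cauchy--Schwarz on the product space, applied to the two parts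
  separately (\<open>Cauchy_Schwarz_Re_Im\<close>), produces the two terms of the bound: the imaginary part gives
  the covariance with absolute values inside, and the real part gives \<open>(sin \<alpha>)\<^sup>2 / 4\<close>, since
  \<open>\<integral> (t - \<mu>) \<psi> \<partial>\<^sub>t\<psi> dt = - \<integral> \<psi>\<^sup>2 dt / 2\<close> for almost every \<open>\<eta>\<close>
  (\<open>position_derivative_correlation_ge\<close>) and the total energy is \<open>1\<close>.

  Only the inequality \<open>2 \<pi> \<integral> \<bar>G'\<bar>\<^sup>2 \<le> \<integral> \<omega>\<^sup>2 \<bar>fourier G \<omega>\<bar>\<^sup>2 d\<omega>\<close> is used from Fourier analysis
  (\<open>Plancherel_derivative_le\<close>). It is obtained by two applications of Fatou's lemma: one to the
  autocorrelation at small shifts, averaged with a Gaussian weight (\<open>Plancherel_le\<close>), and one to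
  difference quotients. All final estimates are between extended nonnegative integrals, so an
  infinite spread needs no separate treatment.
\<close>

section \<open>Half of Plancherel's theorem\<close>

definition fourier :: "(real \<Rightarrow> complex) \<Rightarrow> real \<Rightarrow> complex" where
  "fourier u \<omega> = (CLINT t|lborel. u t * iexp (- (\<omega> * t)))"

definition autocorrelation :: "(real \<Rightarrow> complex) \<Rightarrow> real \<Rightarrow> complex" where
  "autocorrelation u s = (CLINT x|lborel. u x * cnj (u (x + s)))"

lemma borel_measurable_cnj [measurable]: "cnj \<in> borel_measurable borel"
  by (intro borel_measurable_continuous_onI continuous_intros)

lemma borel_measurable_complex_of_real [measurable]: "complex_of_real \<in> borel_measurable borel"
  by (intro borel_measurable_continuous_onI continuous_intros)

lemma (in pair_sigma_finite) integrable_product: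
  fixes f g :: "_ \<Rightarrow> complex"
  assumes f: "integrable M1 f" and g: "integrable M2 g"
  shows "integrable (M1 \<Otimes>\<^sub>M M2) (\<lambda>(x, y). f x * g y)"
proof (rule Fubini_integrable)
  have [measurable]: "f \<in> borel_measurable M1" "g \<in> borel_measurable M2"
    using f g by auto
  show "(\<lambda>(x, y). f x * g y) \<in> borel_measurable (M1 \<Otimes>\<^sub>M M2)"
    by measurable
  show "integrable M1 (\<lambda>x. \<integral>y. norm (case (x, y) of (x, y) \<Rightarrow> f x * g y) \<partial>M2)"
    using f by (simp add: norm_mult)
qed (use g in simp)

lemma integrable_mult_iexp:
  fixes u :: "'a \<Rightarrow> complex"
  assumes "integrable M u" and [measurable]: "p \<in> borel_measurable M"
  shows "integrable M (\<lambda>t. u t * iexp (p t))"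
  by (rule Bochner_Integration.integrable_bound[OF assms(1)])
     (use assms in \<open>auto simp: norm_mult\<close>)

lemma norm_fourier_square:
  assumes u: "integrable lborel u"
  shows "complex_of_real ((cmod (fourier u \<omega>))\<^sup>2) =
    (CLINT p|lborel \<Otimes>\<^sub>M lborel. (case p of (x, y) \<Rightarrow> u x * cnj (u y) * iexp (\<omega> * (y - x))))"
proof -
  have i1: "integrable lborel (\<lambda>x. u x * iexp (- (\<omega> * x)))"
    by (rule integrable_mult_iexp[OF u]) simp
  have i2: "integrable lborel (\<lambda>y. cnj (u y) * iexp (\<omega> * y))"
    by (rule integrable_mult_iexp) (use u in auto)
  have "cnj (fourier u \<omega>) = (CLINT y|lborel. cnj (u y) * iexp (\<omega> * y))"
  proof -
    have "cnj (fourier u \<omega>) = (CLINT y|lborel. cnj (u y * iexp (- (\<omega> * y))))"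
      unfolding fourier_def by (rule Bochner_Integration.integral_cnj[symmetric])
    also have "\<dots> = (CLINT y|lborel. cnj (u y) * iexp (\<omega> * y))"
      by (intro Bochner_Integration.integral_cong refl) (simp add: exp_cnj)
    finally show ?thesis .
  qed
  then have "complex_of_real ((cmod (fourier u \<omega>))\<^sup>2) =
      (CLINT x|lborel. u x * iexp (- (\<omega> * x))) * (CLINT y|lborel. cnj (u y) * iexp (\<omega> * y))"
    unfolding complex_norm_square fourier_def by simp
  also have "\<dots> = (CLINT x|lborel. CLINT y|lborel. (u x * iexp (- (\<omega> * x))) * (cnj (u y) * iexp (\<omega> * y)))"
    by (simp add: i2)
  also have "\<dots> = (CLINT p|lborel \<Otimes>\<^sub>M lborel. (case p of (x, y) \<Rightarrow> (u x * iexp (- (\<omega> * x))) * (cnj (u y) * iexp (\<omega> * y))))"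
    using lborel_pair.integral_fst'[OF lborel_pair.integrable_product[OF i1 i2]] by simp
  also have "\<dots> = (CLINT p|lborel \<Otimes>\<^sub>M lborel. (case p of (x, y) \<Rightarrow> u x * cnj (u y) * iexp (\<omega> * (y - x))))"
    by (intro Bochner_Integration.integral_cong refl)
       (auto simp: exp_add[symmetric] algebra_simps simp flip: exp_add)
  finally show ?thesis .
qed

text \<open>Averaging the power spectrum against a Gaussian turns \<open>iexp (w * (y - x) / \<delta>)\<close> into the
  characteristic function \<open>exp (- ((y - x) / \<delta>)\<^sup>2 / 2)\<close>, which is again a Gaussian. After the
  substitution \<open>y = x + \<delta> z\<close> it becomes the weight of an average of the autocorrelation over
  small shifts. The Gaussian factor is what makes every exchange of integrals absolutely convergent,
  since the power spectrum itself is not known to be integrable.\<close>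

lemma gaussian_mean_autocorrelation:
  assumes u: "integrable lborel u" and \<delta>: "\<delta> > 0"
  shows "(CLINT w|std_normal_distribution. complex_of_real ((cmod (fourier u (w / \<delta>)))\<^sup>2)) =
    complex_of_real (\<delta> * sqrt (2 * pi)) *
    (CLINT z|std_normal_distribution. autocorrelation u (\<delta> * z))"
proof -
  let ?N = "std_normal_distribution" and ?L = "lborel :: real measure"
  let ?v = "\<lambda>(x, y). u x * cnj (u y)"
  interpret N: prob_space ?N by (simp add: prob_space_normal_density)
  interpret P: pair_sigma_finite ?N "?L \<Otimes>\<^sub>M ?L" ..
  have [measurable]: "u \<in> borel_measurable borel" using u by auto
  have v: "integrable (?L \<Otimes>\<^sub>M ?L) ?v"
    using lborel_pair.integrable_product[OF u, of "\<lambda>y. cnj (u y)"] u by simp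
  have K: "integrable (?N \<Otimes>\<^sub>M (?L \<Otimes>\<^sub>M ?L)) (\<lambda>(w, p). ?v p * iexp (w * ((snd p - fst p) / \<delta>)))"
  proof -
    have "integrable (?N \<Otimes>\<^sub>M (?L \<Otimes>\<^sub>M ?L)) (\<lambda>(w, p). 1 * ?v p)"
      by (rule P.integrable_product) (use v in auto)
    from integrable_mult_iexp[OF this, of "\<lambda>(w, p). w * ((snd p - fst p) / \<delta>)"]
    show ?thesis by (simp add: split_beta')
  qed
  have ker: "integrable (?L \<Otimes>\<^sub>M ?L) (\<lambda>(x, y). u x * cnj (u y) * exp (- ((y - x) / \<delta>)\<^sup>2 / 2))"
  proof (rule Bochner_Integration.integrable_bound[OF v])
    show "(\<lambda>(x, y). u x * cnj (u y) * exp (- ((y - x) / \<delta>)\<^sup>2 / 2)) \<in> borel_measurable (?L \<Otimes>\<^sub>M ?L)"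
      by measurable
  qed (auto simp: norm_mult mult_left_le)
  have Fub: "integrable (?L \<Otimes>\<^sub>M ?L) (\<lambda>(x, z). u x * cnj (u (x + \<delta> * z)) * exp (- z\<^sup>2 / 2))"
  proof (rule lborel_pair.Fubini_integrable)
    have nker: "integrable (?L \<Otimes>\<^sub>M ?L) (\<lambda>(x, y). cmod (u x * cnj (u y) * exp (- ((y - x) / \<delta>)\<^sup>2 / 2)))"
      using integrable_norm[OF ker] by (simp add: split_beta')
    have "integrable ?L (\<lambda>x. (\<integral>y. cmod (u x * cnj (u y) * exp (- ((y - x) / \<delta>)\<^sup>2 / 2)) \<partial>?L))"
      using lborel_pair.integrable_fst[OF nker] .
    also have "(\<lambda>x. (\<integral>y. cmod (u x * cnj (u y) * exp (- ((y - x) / \<delta>)\<^sup>2 / 2)) \<partial>?L)) =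
       (\<lambda>x. \<delta> * (\<integral>z. cmod (u x * cnj (u (x + \<delta> * z)) * exp (- z\<^sup>2 / 2)) \<partial>?L))"
    proof
      fix x
      show "(\<integral>y. cmod (u x * cnj (u y) * exp (- ((y - x) / \<delta>)\<^sup>2 / 2)) \<partial>?L) =
        \<delta> * (\<integral>z. cmod (u x * cnj (u (x + \<delta> * z)) * exp (- z\<^sup>2 / 2)) \<partial>?L)"
        using \<delta> by (subst lborel_integral_real_affine[where c=\<delta> and t=x]) auto
    qed
    finally have "integrable ?L (\<lambda>x. (1/\<delta>) * (\<delta> * (\<integral>z. cmod (u x * cnj (u (x + \<delta> * z)) * exp (- z\<^sup>2 / 2)) \<partial>?L)))"
      by (rule integrable_mult_right)
    then show "integrable ?L (\<lambda>x. \<integral>z. norm (case (x, z) of (x, z) \<Rightarrow> u x * cnj (u (x + \<delta> * z)) * exp (- z\<^sup>2 / 2)) \<partial>?L)"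
      using \<delta> by simp
    show "AE x in ?L. integrable ?L (\<lambda>z. case (x, z) of (x, z) \<Rightarrow> u x * cnj (u (x + \<delta> * z)) * exp (- z\<^sup>2 / 2))"
      using lborel_pair.AE_integrable_fst'[OF ker]
    proof eventually_elim
      case (elim x)
      from lborel_integrable_real_affine[OF this, of \<delta> x] \<delta> show ?case by simp
    qed
  qed measurable
  have "(CLINT w|?N. complex_of_real ((cmod (fourier u (w / \<delta>)))\<^sup>2)) =
      (CLINT w|?N. CLINT p|?L \<Otimes>\<^sub>M ?L. ?v p * iexp (w * ((snd p - fst p) / \<delta>)))"
    unfolding norm_fourier_square[OF u] by (simp add: split_beta')
  also have "\<dots> = (CLINT p|?L \<Otimes>\<^sub>M ?L. CLINT w|?N. ?v p * iexp (w * ((snd p - fst p) / \<delta>)))"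
    using P.Fubini_integral[OF K] by simp
  also have "\<dots> = (CLINT p|?L \<Otimes>\<^sub>M ?L. ?v p * char ?N ((snd p - fst p) / \<delta>))"
    unfolding char_def by (simp add: mult.commute)
  also have "\<dots> = (CLINT p|?L \<Otimes>\<^sub>M ?L. (case p of (x, y) \<Rightarrow> u x * cnj (u y) * exp (- ((y - x) / \<delta>)\<^sup>2 / 2)))"
    unfolding char_std_normal_distribution
    by (intro Bochner_Integration.integral_cong refl) (auto simp flip: exp_of_real)
  also have "\<dots> = (CLINT x|?L. CLINT y|?L. u x * cnj (u y) * exp (- ((y - x) / \<delta>)\<^sup>2 / 2))"
    using lborel_pair.integral_fst'[OF ker] by simp
  also have "\<dots> = (CLINT x|?L. complex_of_real \<delta> * (CLINT z|?L. u x * cnj (u (x + \<delta> * z)) * exp (- z\<^sup>2 / 2)))"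
  proof (intro Bochner_Integration.integral_cong refl)
    fix x
    show "(CLINT y|?L. u x * cnj (u y) * exp (- ((y - x) / \<delta>)\<^sup>2 / 2)) =
      complex_of_real \<delta> * (CLINT z|?L. u x * cnj (u (x + \<delta> * z)) * exp (- z\<^sup>2 / 2))"
      using \<delta> by (subst lborel_integral_real_affine[where c=\<delta> and t=x]) (auto simp: scaleR_conv_of_real)
  qed
  also have "\<dots> = complex_of_real \<delta> * (CLINT x|?L. CLINT z|?L. u x * cnj (u (x + \<delta> * z)) * exp (- z\<^sup>2 / 2))"
    by simp
  also have "\<dots> = complex_of_real \<delta> * (CLINT z|?L. CLINT x|?L. u x * cnj (u (x + \<delta> * z)) * exp (- z\<^sup>2 / 2))"
    using lborel_pair.Fubini_integral[OF Fub] by simp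
  also have "\<dots> = complex_of_real \<delta> * (CLINT z|?L. complex_of_real (sqrt (2 * pi)) * (std_normal_density z *\<^sub>R autocorrelation u (\<delta> * z)))"
  proof -
    have "(CLINT x|?L. u x * cnj (u (x + \<delta> * z)) * exp (- z\<^sup>2 / 2)) =
        complex_of_real (sqrt (2 * pi)) * (std_normal_density z *\<^sub>R autocorrelation u (\<delta> * z))" for z
      unfolding autocorrelation_def std_normal_density_def integral_mult_left_zero
      by (simp add: scaleR_conv_of_real)
    then show ?thesis by simp
  qed
  also have "\<dots> = complex_of_real (\<delta> * sqrt (2 * pi)) *  (CLINT z|?N. autocorrelation u (\<delta> * z))"
  proof -
    have [measurable]: "autocorrelation u \<in> borel_measurable borel"
      unfolding autocorrelation_def by measurable
    show ?thesis
      unfolding integral_mult_right_zero by (subst integral_density) (auto simp: mult.assoc)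
  qed
  finally show ?thesis .
qed

lemma abs_mult_le_sum_squares: "\<bar>a * b\<bar> \<le> a\<^sup>2 + (b::real)\<^sup>2"
proof -
  have "2 * \<bar>a * b\<bar> \<le> a\<^sup>2 + b\<^sup>2"
    using sum_squares_bound[of "\<bar>a\<bar>" "\<bar>b\<bar>"] by (simp add: abs_mult)
  then show ?thesis by linarith
qed

lemma integrable_autocorrelation:
  fixes u :: "real \<Rightarrow> complex"
  assumes u: "u \<in> borel_measurable borel" "integrable lborel (\<lambda>x. (cmod (u x))\<^sup>2)"
  shows "integrable lborel (\<lambda>x. u x * cnj (u (x + s)))"
    and "integrable lborel (\<lambda>x. (cmod (u (x + s)))\<^sup>2)"
    and "(LINT x|lborel. (cmod (u (x + s)))\<^sup>2) = (LINT x|lborel. (cmod (u x))\<^sup>2)"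
proof -
  note [measurable] = u(1)
  show shift: "integrable lborel (\<lambda>x. (cmod (u (x + s)))\<^sup>2)"
    using lborel_integrable_real_affine[OF u(2), of 1 s] by (simp add: add.commute)
  show "(LINT x|lborel. (cmod (u (x + s)))\<^sup>2) = (LINT x|lborel. (cmod (u x))\<^sup>2)"
    by (subst (2) lborel_integral_real_affine[where c=1 and t=s]) (auto simp: add.commute)
  show "integrable lborel (\<lambda>x. u x * cnj (u (x + s)))"
  proof (rule Bochner_Integration.integrable_bound)
    show "integrable lborel (\<lambda>x. (cmod (u x))\<^sup>2 + (cmod (u (x + s)))\<^sup>2)"
      using u(2) shift by simp
    have "norm (u x * cnj (u (x + s))) \<le> norm ((cmod (u x))\<^sup>2 + (cmod (u (x + s)))\<^sup>2)" for x
      using abs_mult_le_sum_squares[of "cmod (u x)" "cmod (u (x + s))"] by (simp add: norm_mult)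
    then show "AE x in lborel. norm (u x * cnj (u (x + s))) \<le> norm ((cmod (u x))\<^sup>2 + (cmod (u (x + s)))\<^sup>2)"
      by simp
  qed measurable
qed

text \<open>Polarization writes the real part of the autocorrelation as an integral of a nonnegative
  function, which is the form to which Fatou's lemma applies.\<close>

lemma autocorrelation_polarization:
  assumes u: "u \<in> borel_measurable borel" "integrable lborel (\<lambda>x. (cmod (u x))\<^sup>2)"
  shows "has_bochner_integral lborel (\<lambda>x. (cmod (u x + u (x + s)))\<^sup>2)
    (2 * (LINT x|lborel. (cmod (u x))\<^sup>2) + 2 * Re (autocorrelation u s))"
proof -
  note int = integrable_autocorrelation[OF u, of s]
  have "has_bochner_integral lborel (\<lambda>x. u x * cnj (u (x + s))) (autocorrelation u s)"
    unfolding autocorrelation_def using int(1) by (rule has_bochner_integral_integrable)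
  then have "has_bochner_integral lborel (\<lambda>x. Re (u x * cnj (u (x + s)))) (Re (autocorrelation u s))"
    by (rule has_bochner_integral_bounded_linear[OF bounded_linear_Re])
  then have "has_bochner_integral lborel
     (\<lambda>x. (cmod (u x))\<^sup>2 + (cmod (u (x + s)))\<^sup>2 + 2 * Re (u x * cnj (u (x + s))))
     ((LINT x|lborel. (cmod (u x))\<^sup>2) + (LINT x|lborel. (cmod (u x))\<^sup>2) + 2 * Re (autocorrelation u s))"
    using u(2) int(2,3)
    by (intro has_bochner_integral_add has_bochner_integral_mult_right)
       (auto simp: has_bochner_integral_iff)
  moreover have "(cmod (a + b))\<^sup>2 = (cmod a)\<^sup>2 + (cmod b)\<^sup>2 + 2 * Re (a * cnj b)" for a b
    unfolding cmod_power2 by (simp add: power2_eq_square algebra_simps)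
  ultimately show ?thesis by simp
qed

lemma autocorrelation_bound:
  assumes u: "u \<in> borel_measurable borel" "integrable lborel (\<lambda>x. (cmod (u x))\<^sup>2)"
  shows "cmod (autocorrelation u s) \<le> (LINT x|lborel. (cmod (u x))\<^sup>2)"
proof -
  note int = integrable_autocorrelation[OF u, of s]
  have "cmod (autocorrelation u s) \<le> (LINT x|lborel. cmod (u x * cnj (u (x + s))))"
    unfolding autocorrelation_def by (rule integral_norm_bound)
  also have "\<dots> \<le> (LINT x|lborel. ((cmod (u x))\<^sup>2 + (cmod (u (x + s)))\<^sup>2) / 2)"
    using int u(2) sum_squares_bound[of "cmod (u _)" "cmod (u _)"]
    by (intro integral_mono integrable_norm) (auto simp: norm_mult field_simps)
  also have "\<dots> = (LINT x|lborel. (cmod (u x))\<^sup>2)"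
    using int u(2) by simp
  finally show ?thesis .
qed

text \<open>The autocorrelation never exceeds its value at \<open>0\<close> in modulus. Fatou's lemma for
  \<open>\<bar>u x + u (x + s)\<bar>\<^sup>2\<close>, which tends to \<open>4 \<bar>u x\<bar>\<^sup>2\<close> by continuity, gives the opposite
  inequality in the limit, without an approximation by functions of compact support.\<close>

lemma autocorrelation_tendsto:
  assumes cont: "continuous_on UNIV u" and u: "integrable lborel (\<lambda>x. (cmod (u x))\<^sup>2)" and s: "s \<longlonglongrightarrow> 0"
  shows "(\<lambda>n. Re (autocorrelation u (s n))) \<longlonglongrightarrow> (LINT x|lborel. (cmod (u x))\<^sup>2)"
proof -
  define I where "I = (LINT x|lborel. (cmod (u x))\<^sup>2)"
  have [measurable]: "u \<in> borel_measurable borel"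
    using cont by (rule borel_measurable_continuous_onI)
  have bd: "\<bar>Re (autocorrelation u t)\<bar> \<le> I" for t
    using order_trans[OF abs_Re_le_cmod autocorrelation_bound[OF _ u]] unfolding I_def by simp
  note pol = autocorrelation_polarization[OF _ u, folded I_def]
  have "ennreal (4 * I) = (\<integral>\<^sup>+x. ennreal (4 * (cmod (u x))\<^sup>2) \<partial>lborel)"
    unfolding I_def using u by (subst nn_integral_eq_integral) auto
  also have "\<dots> = (\<integral>\<^sup>+x. liminf (\<lambda>n. ennreal ((cmod (u x + u (x + s n)))\<^sup>2)) \<partial>lborel)"
  proof (intro nn_integral_cong)
    fix x
    have "isCont u x" using cont by (simp add: continuous_on_eq_continuous_at)
    moreover have "(\<lambda>n. x + s n) \<longlonglongrightarrow> x" using tendsto_add[OF tendsto_const s, of x] by simp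
    ultimately have "(\<lambda>n. u (x + s n)) \<longlonglongrightarrow> u x" by (rule isCont_tendsto_compose)
    then have "(\<lambda>n. ennreal ((cmod (u x + u (x + s n)))\<^sup>2)) \<longlonglongrightarrow> ennreal ((cmod (u x + u x))\<^sup>2)"
      by (intro tendsto_intros)
    then have "liminf (\<lambda>n. ennreal ((cmod (u x + u (x + s n)))\<^sup>2)) = ennreal ((cmod (u x + u x))\<^sup>2)"
      by (intro lim_imp_Liminf) auto
    moreover have "u x + u x = 2 * u x" by simp
    ultimately show "ennreal (4 * (cmod (u x))\<^sup>2) = liminf (\<lambda>n. ennreal ((cmod (u x + u (x + s n)))\<^sup>2))"
      by (simp add: norm_mult power_mult_distrib del: mult_2)
  qed
  also have "\<dots> \<le> liminf (\<lambda>n. \<integral>\<^sup>+x. ennreal ((cmod (u x + u (x + s n)))\<^sup>2) \<partial>lborel)"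
    by (rule nn_integral_liminf) measurable
  also have "(\<lambda>n. \<integral>\<^sup>+x. ennreal ((cmod (u x + u (x + s n)))\<^sup>2) \<partial>lborel) =
      (\<lambda>n. ennreal (2 * I + 2 * Re (autocorrelation u (s n))))"
    using pol by (auto simp: has_bochner_integral_iff nn_integral_eq_integral)
  finally have Fatou: "ennreal (4 * I) \<le> liminf (\<lambda>n. ennreal (2 * I + 2 * Re (autocorrelation u (s n))))" .
  show ?thesis unfolding I_def[symmetric]
  proof (rule order_tendstoI)
    fix a assume "a < I"
    show "\<forall>\<^sub>F n in sequentially. a < Re (autocorrelation u (s n))"
    proof (cases "I = 0")
      case True then show ?thesis using bd[of "s _"] \<open>a < I\<close> by (simp add: abs_le_zero_iff)
    next
      case False
      have "0 \<le> I" unfolding I_def by simp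
      with False have "ennreal (2 * I + 2 * a) < ennreal (4 * I)"
        using \<open>a < I\<close> by (intro ennreal_lessI) auto
      from less_LiminfD[OF less_le_trans[OF this Fatou]] show ?thesis
        by eventually_elim (smt (verit) ennreal_leI linorder_not_le)
    qed
  next
    fix a assume "I < a"
    then show "\<forall>\<^sub>F n in sequentially. Re (autocorrelation u (s n)) < a"
      using bd[of "s _"] by (intro always_eventually allI) (smt (verit))
  qed
qed

lemma measurable_fourier:
  assumes [measurable]: "u \<in> borel_measurable borel"
  shows "fourier u \<in> borel_measurable borel"
  unfolding fourier_def by measurable

lemma norm_fourier_le:
  assumes "integrable lborel u"
  shows "cmod (fourier u \<omega>) \<le> (LINT t|lborel. cmod (u t))"
  unfolding fourier_def
  by (rule order_trans[OF integral_norm_bound]) (simp add: norm_mult)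

text \<open>Half of Plancherel's theorem. The Gaussian density is at most \<open>1 / sqrt (2 \<pi>)\<close>, so the Gaussian
  mean of the power spectrum is bounded by its full integral, for every \<open>\<delta>\<close>; as \<open>\<delta>\<close> tends
  to \<open>0\<close>, the corresponding mean of the autocorrelation tends to its value at \<open>0\<close>, the energy
  of \<open>u\<close>.\<close>

lemma Plancherel_le:
  assumes cont: "continuous_on UNIV u" and u: "integrable lborel u" "integrable lborel (\<lambda>x. (cmod (u x))\<^sup>2)"
  shows "ennreal (2 * pi * (LINT x|lborel. (cmod (u x))\<^sup>2)) \<le> (\<integral>\<^sup>+\<omega>. ennreal ((cmod (fourier u \<omega>))\<^sup>2) \<partial>lborel)"
proof -
  define I where "I = (LINT x|lborel. (cmod (u x))\<^sup>2)"
  let ?N = "std_normal_distribution"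
  interpret N: prob_space ?N by (simp add: prob_space_normal_density)
  have [measurable]: "u \<in> borel_measurable borel"
    using cont by (rule borel_measurable_continuous_onI)
  note [measurable] = measurable_fourier[of u]
  have [measurable]: "autocorrelation u \<in> borel_measurable borel"
    unfolding autocorrelation_def by measurable
  have bound: "cmod (autocorrelation u s) \<le> I" for s
    unfolding I_def by (rule autocorrelation_bound) (use u in auto)
  have bnd: "ennreal (2 * pi * (LINT z|?N. Re (autocorrelation u (\<delta> * z)))) \<le>
      (\<integral>\<^sup>+\<omega>. ennreal ((cmod (fourier u \<omega>))\<^sup>2) \<partial>lborel)" if \<delta>: "\<delta> > 0" for \<delta>
  proof -
    define B where "B = (LINT t|lborel. cmod (u t))"
    have int: "integrable ?N (\<lambda>w. (cmod (fourier u (w / \<delta>)))\<^sup>2)"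
      by (rule N.integrable_const_bound[where B="B\<^sup>2"])
         (auto intro!: power_mono norm_fourier_le[OF u(1)] simp: B_def)
    have A: "integrable ?N (\<lambda>z. autocorrelation u (\<delta> * z))"
      by (rule N.integrable_const_bound[where B="I"]) (auto intro: bound)
    have "(LINT w|?N. (cmod (fourier u (w / \<delta>)))\<^sup>2) = \<delta> * sqrt (2 * pi) * (LINT z|?N. Re (autocorrelation u (\<delta> * z)))"
      using arg_cong[OF gaussian_mean_autocorrelation[OF u(1) \<delta>, unfolded integral_complex_of_real], of Re] A
      by simp
    then have "ennreal (\<delta> * sqrt (2 * pi) * (LINT z|?N. Re (autocorrelation u (\<delta> * z)))) =
        (\<integral>\<^sup>+w. ennreal ((cmod (fourier u (w / \<delta>)))\<^sup>2) \<partial>?N)"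
      using int by (simp add: nn_integral_eq_integral)
    also have "\<dots> = (\<integral>\<^sup>+w. ennreal (std_normal_density w) * ennreal ((cmod (fourier u (w / \<delta>)))\<^sup>2) \<partial>lborel)"
      by (subst nn_integral_density) auto
    also have "\<dots> \<le> (\<integral>\<^sup>+w. ennreal (1 / sqrt (2 * pi)) * ennreal ((cmod (fourier u (w / \<delta>)))\<^sup>2) \<partial>lborel)"
      by (intro nn_integral_mono mult_right_mono ennreal_leI)
         (auto simp: std_normal_density_def divide_right_mono)
    also have "\<dots> = ennreal (1 / sqrt (2 * pi)) * (\<integral>\<^sup>+w. ennreal ((cmod (fourier u (w / \<delta>)))\<^sup>2) \<partial>lborel)"
      by (rule nn_integral_cmult) measurable
    also have "(\<integral>\<^sup>+w. ennreal ((cmod (fourier u (w / \<delta>)))\<^sup>2) \<partial>lborel) =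
        ennreal \<delta> * (\<integral>\<^sup>+\<omega>. ennreal ((cmod (fourier u \<omega>))\<^sup>2) \<partial>lborel)"
      using \<delta> by (subst nn_integral_real_affine[where c=\<delta> and t=0]) auto
    finally have *: "ennreal (\<delta> * sqrt (2 * pi) * (LINT z|?N. Re (autocorrelation u (\<delta> * z)))) \<le>
      ennreal (1 / sqrt (2 * pi)) * (ennreal \<delta> * (\<integral>\<^sup>+\<omega>. ennreal ((cmod (fourier u \<omega>))\<^sup>2) \<partial>lborel))" .
    have "2 * pi * m = sqrt (2 * pi) / \<delta> * (\<delta> * sqrt (2 * pi) * m)" for m
    proof -
      have "sqrt (2 * pi) / \<delta> * (\<delta> * sqrt (2 * pi) * m) = sqrt (2 * pi) * sqrt (2 * pi) * m"
        using \<delta> by (simp only: field_simps) simp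
      then show ?thesis by simp
    qed
    then have "ennreal (2 * pi * (LINT z|?N. Re (autocorrelation u (\<delta> * z)))) =
        ennreal (sqrt (2 * pi) / \<delta> * (\<delta> * sqrt (2 * pi) * (LINT z|?N. Re (autocorrelation u (\<delta> * z)))))"
      by (rule arg_cong)
    also have "\<dots> = ennreal (sqrt (2 * pi) / \<delta>) * ennreal (\<delta> * sqrt (2 * pi) * (LINT z|?N. Re (autocorrelation u (\<delta> * z))))"
      using \<delta> by (intro ennreal_mult') simp
    also have "\<dots> \<le> ennreal (sqrt (2 * pi) / \<delta>) *
       (ennreal (1 / sqrt (2 * pi)) * (ennreal \<delta> * (\<integral>\<^sup>+\<omega>. ennreal ((cmod (fourier u \<omega>))\<^sup>2) \<partial>lborel)))"
      by (rule mult_left_mono[OF *]) simp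
    also have "\<dots> = ennreal (sqrt (2 * pi) / \<delta> * (1 / sqrt (2 * pi) * \<delta>)) * (\<integral>\<^sup>+\<omega>. ennreal ((cmod (fourier u \<omega>))\<^sup>2) \<partial>lborel)"
    proof -
      have "ennreal (sqrt (2 * pi) / \<delta> * (1 / sqrt (2 * pi) * \<delta>)) =
          ennreal (sqrt (2 * pi) / \<delta>) * (ennreal (1 / sqrt (2 * pi)) * ennreal \<delta>)"
        using \<delta> by (subst ennreal_mult', simp, subst ennreal_mult', simp_all)
      then show ?thesis by (simp only: mult.assoc)
    qed
    finally show ?thesis using \<delta> by simp
  qed
  have "(\<lambda>n. LINT z|?N. Re (autocorrelation u (1 / real (Suc n) * z))) \<longlonglongrightarrow> (LINT z|?N. I)"
  proof (rule integral_dominated_convergence[where w="\<lambda>_. I"])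
    show "AE z in ?N. (\<lambda>n. Re (autocorrelation u (1 / real (Suc n) * z))) \<longlonglongrightarrow> I"
      unfolding I_def
      by (intro AE_I2 autocorrelation_tendsto[OF cont u(2)] tendsto_mult_left_zero LIMSEQ_Suc lim_1_over_n)
  qed (auto intro: order_trans[OF abs_Re_le_cmod bound])
  moreover have "(LINT z|?N. I) = I"
    using N.prob_space by simp
  ultimately have "(\<lambda>n. LINT z|?N. Re (autocorrelation u (1 / real (Suc n) * z))) \<longlonglongrightarrow> I"
    by (simp only:)
  then have "(\<lambda>n. ennreal (2 * pi * (LINT z|?N. Re (autocorrelation u (1 / real (Suc n) * z))))) \<longlonglongrightarrow> ennreal (2 * pi * I)"
    by (intro tendsto_ennrealI tendsto_mult_left)
  then show ?thesis
    unfolding I_def[symmetric]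
    by (rule LIMSEQ_le_const2) (intro exI allI impI bnd, simp)
qed

section \<open>Derivatives and the second moment of the spectrum\<close>

text \<open>The steps run through the reciprocals \<open>1 / Suc n\<close>, because Fatou's lemma needs a sequence and
  because a limit of a sequence of measurable functions is measurable.\<close>

definition difference_quotient :: "nat \<Rightarrow> (real \<Rightarrow> complex) \<Rightarrow> real \<Rightarrow> complex" where
  "difference_quotient n G t = complex_of_real (real (Suc n)) * (G (t + 1 / real (Suc n)) - G t)"

lemma difference_quotient_tendsto:
  assumes "(G has_vector_derivative D) (at t)"
  shows "(\<lambda>n. difference_quotient n G t) \<longlonglongrightarrow> D"
proof -
  have "((\<lambda>h. norm (G (t + h) - G t - h *\<^sub>R D) / norm h) \<longlongrightarrow> 0) (at 0)"
    using assms by (simp add: has_vector_derivative_def has_derivative_at)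
  moreover have "filterlim (\<lambda>n. 1 / real (Suc n)) (at 0) sequentially"
    unfolding filterlim_at using LIMSEQ_Suc[OF lim_1_over_n] by auto
  ultimately have "(\<lambda>n. norm (G (t + 1 / real (Suc n)) - G t - (1 / real (Suc n)) *\<^sub>R D) / norm (1 / real (Suc n))) \<longlonglongrightarrow> 0"
    by (rule filterlim_compose)
  also have "(\<lambda>n. norm (G (t + 1 / real (Suc n)) - G t - (1 / real (Suc n)) *\<^sub>R D) / norm (1 / real (Suc n))) =
     (\<lambda>n. norm (difference_quotient n G t - D))"
  proof
    fix n
    have "difference_quotient n G t - D =
        complex_of_real (real (Suc n)) * (G (t + 1 / real (Suc n)) - G t - (1 / real (Suc n)) *\<^sub>R D)"
      unfolding difference_quotient_def by (simp add: scaleR_conv_of_real field_simps del: of_nat_Suc)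
    then show "norm (G (t + 1 / real (Suc n)) - G t - (1 / real (Suc n)) *\<^sub>R D) / norm (1 / real (Suc n)) =
        norm (difference_quotient n G t - D)"
      by (simp add: norm_mult del: of_nat_Suc)
  qed
  finally show ?thesis
    using LIM_zero_cancel tendsto_norm_zero_iff by blast
qed

lemma fourier_translate:
  "fourier (\<lambda>t. u (t + h)) \<omega> = iexp (\<omega> * h) * fourier u \<omega>"
proof -
  have "fourier u \<omega> = (CLINT t|lborel. u (h + 1 * t) * iexp (- (\<omega> * (h + 1 * t))))"
    unfolding fourier_def by (subst lborel_integral_real_affine[where c=1 and t=h]) auto
  also have "\<dots> = (CLINT t|lborel. iexp (- (\<omega> * h)) * (u (t + h) * iexp (- (\<omega> * t))))"
    by (intro Bochner_Integration.integral_cong refl)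
       (simp add: exp_add[symmetric] algebra_simps)
  also have "\<dots> = iexp (- (\<omega> * h)) * fourier (\<lambda>t. u (t + h)) \<omega>"
    unfolding fourier_def by (rule integral_mult_right_zero)
  finally have "iexp (\<omega> * h) * fourier u \<omega> =
      (iexp (\<omega> * h) * iexp (- (\<omega> * h))) * fourier (\<lambda>t. u (t + h)) \<omega>"
    by simp
  also have "iexp (\<omega> * h) * iexp (- (\<omega> * h)) = 1"
    by (simp add: exp_add[symmetric])
  finally show ?thesis by simp
qed

lemma integrable_translate:
  fixes u :: "real \<Rightarrow> complex"
  assumes "integrable lborel u"
  shows "integrable lborel (\<lambda>t. u (t + h))"
  using lborel_integrable_real_affine[OF assms, of 1 h] by (simp add: add.commute)

lemma fourier_difference_quotient_le:
  assumes u: "integrable lborel u"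
  shows "cmod (fourier (difference_quotient n u) \<omega>) \<le> \<bar>\<omega>\<bar> * cmod (fourier u \<omega>)"
proof -
  define N where "N = real (Suc n)"
  have N: "N > 0" unfolding N_def by simp
  have i: "integrable lborel (\<lambda>t. w t * iexp (- (\<omega> * t)))" if "integrable lborel w" for w
    by (rule integrable_mult_iexp[OF that]) simp
  have "fourier (difference_quotient n u) \<omega> =
      (CLINT t|lborel. complex_of_real N * (u (t + 1 / N) * iexp (- (\<omega> * t)) - u t * iexp (- (\<omega> * t))))"
    unfolding fourier_def difference_quotient_def N_def
    by (intro Bochner_Integration.integral_cong refl) (simp add: algebra_simps del: of_nat_Suc)
  also have "\<dots> = complex_of_real N * (fourier (\<lambda>t. u (t + 1 / N)) \<omega> - fourier u \<omega>)"
    unfolding fourier_def integral_mult_right_zero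
    by (subst Bochner_Integration.integral_diff[OF i[OF integrable_translate[OF u]] i[OF u]]) (rule refl)
  also have "\<dots> = complex_of_real N * (iexp (\<omega> * (1 / N)) - 1) * fourier u \<omega>"
    unfolding fourier_translate by (simp add: algebra_simps)
  finally have "cmod (fourier (difference_quotient n u) \<omega>) =
     N * cmod (iexp (\<omega> * (1 / N)) - 1) * cmod (fourier u \<omega>)"
    using N by (simp add: norm_mult)
  also have "\<dots> \<le> N * \<bar>\<omega> * (1 / N)\<bar> * cmod (fourier u \<omega>)"
    using iexp_approx1[of "\<omega> * (1 / N)" 0] N
    by (intro mult_left_mono mult_right_mono) auto
  also have "\<dots> = \<bar>\<omega>\<bar> * cmod (fourier u \<omega>)"
    using N by (simp add: abs_mult)
  finally show ?thesis .
qed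

text \<open>The Fourier transform of the derivative is never formed, since \<open>G'\<close> need not be integrable.
  Each difference quotient is integrable, its transform is at most \<open>\<bar>\<omega>\<bar> \<bar>fourier G \<omega>\<bar>\<close> because
  \<open>\<bar>iexp x - 1\<bar> \<le> \<bar>x\<bar>\<close>, and Fatou's lemma passes the bound on its energy to the derivative.\<close>

lemma Plancherel_derivative_le:
  assumes deriv: "\<And>t. (G has_vector_derivative G' t) (at t)"
    and G: "integrable lborel G" "integrable lborel (\<lambda>t. (cmod (G t))\<^sup>2)"
  shows "(\<integral>\<^sup>+t. ennreal (2 * pi * (cmod (G' t))\<^sup>2) \<partial>lborel) \<le>
    (\<integral>\<^sup>+\<omega>. ennreal (\<omega>\<^sup>2 * (cmod (fourier G \<omega>))\<^sup>2) \<partial>lborel)"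
proof -
  have cont: "continuous_on UNIV G"
    using deriv by (meson continuous_at_imp_continuous_on has_vector_derivative_continuous)
  then have [measurable]: "G \<in> borel_measurable borel"
    by (rule borel_measurable_continuous_onI)
  let ?q = "\<lambda>n. difference_quotient n G"
  have q_cont: "continuous_on UNIV (?q n)" for n
    unfolding difference_quotient_def
    by (intro continuous_intros continuous_on_compose2[OF cont]) auto
  have q_meas: "?q n \<in> borel_measurable borel" for n
    using q_cont by (rule borel_measurable_continuous_onI)
  have q_L1: "integrable lborel (?q n)" for n
    unfolding difference_quotient_def
    by (intro integrable_mult_right Bochner_Integration.integrable_diff integrable_translate G)
  have q_L2: "integrable lborel (\<lambda>t. (cmod (?q n t))\<^sup>2)" for n
  proof (rule Bochner_Integration.integrable_bound)
    let ?N = "real (Suc n)"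
    show "integrable lborel (\<lambda>t. ?N\<^sup>2 * (2 * ((cmod (G (t + 1 / ?N)))\<^sup>2 + (cmod (G t))\<^sup>2)))"
      using integrable_autocorrelation(2)[OF _ G(2)] G(2) by simp
    have "(cmod (a - b))\<^sup>2 \<le> 2 * ((cmod a)\<^sup>2 + (cmod b)\<^sup>2)" for a b
    proof -
      have "(cmod (a - b))\<^sup>2 \<le> (cmod a + cmod b)\<^sup>2"
        by (intro power_mono norm_triangle_ineq4) simp
      also have "\<dots> \<le> 2 * ((cmod a)\<^sup>2 + (cmod b)\<^sup>2)"
        using sum_squares_bound[of "cmod a" "cmod b"] by (simp add: power2_sum)
      finally show ?thesis .
    qed
    then show "AE t in lborel. norm ((cmod (?q n t))\<^sup>2) \<le> norm (?N\<^sup>2 * (2 * ((cmod (G (t + 1 / ?N)))\<^sup>2 + (cmod (G t))\<^sup>2)))"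
      unfolding difference_quotient_def
      by (intro AE_I2) (simp add: norm_mult power_mult_distrib mult_left_mono del: of_nat_Suc)
  qed (use q_meas in measurable)
  have q_bound: "(\<integral>\<^sup>+t. ennreal (2 * pi * (cmod (?q n t))\<^sup>2) \<partial>lborel) \<le>
      (\<integral>\<^sup>+\<omega>. ennreal (\<omega>\<^sup>2 * (cmod (fourier G \<omega>))\<^sup>2) \<partial>lborel)" for n
  proof -
    have "(\<integral>\<^sup>+t. ennreal (2 * pi * (cmod (?q n t))\<^sup>2) \<partial>lborel) = ennreal (2 * pi * (LINT t|lborel. (cmod (?q n t))\<^sup>2))"
      using q_L2[of n] by (subst nn_integral_eq_integral) auto
    also have "\<dots> \<le> (\<integral>\<^sup>+\<omega>. ennreal ((cmod (fourier (?q n) \<omega>))\<^sup>2) \<partial>lborel)"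
      by (rule Plancherel_le[OF q_cont q_L1 q_L2])
    also have "\<dots> \<le> (\<integral>\<^sup>+\<omega>. ennreal (\<omega>\<^sup>2 * (cmod (fourier G \<omega>))\<^sup>2) \<partial>lborel)"
    proof (intro nn_integral_mono ennreal_leI)
      fix \<omega>
      have "(cmod (fourier (?q n) \<omega>))\<^sup>2 \<le> (\<bar>\<omega>\<bar> * cmod (fourier G \<omega>))\<^sup>2"
        by (intro power_mono fourier_difference_quotient_le G) simp
      then show "(cmod (fourier (?q n) \<omega>))\<^sup>2 \<le> \<omega>\<^sup>2 * (cmod (fourier G \<omega>))\<^sup>2"
        by (simp add: power_mult_distrib)
    qed
    finally show ?thesis .
  qed
  have "(\<integral>\<^sup>+t. ennreal (2 * pi * (cmod (G' t))\<^sup>2) \<partial>lborel) =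
      (\<integral>\<^sup>+t. liminf (\<lambda>n. ennreal (2 * pi * (cmod (?q n t))\<^sup>2)) \<partial>lborel)"
  proof (intro nn_integral_cong)
    fix t
    have "(\<lambda>n. ennreal (2 * pi * (cmod (?q n t))\<^sup>2)) \<longlonglongrightarrow> ennreal (2 * pi * (cmod (G' t))\<^sup>2)"
      by (intro tendsto_intros tendsto_ennrealI difference_quotient_tendsto deriv)
    from lim_imp_Liminf[OF _ this]
    show "ennreal (2 * pi * (cmod (G' t))\<^sup>2) = liminf (\<lambda>n. ennreal (2 * pi * (cmod (?q n t))\<^sup>2))"
      by simp
  qed
  also have "\<dots> \<le> liminf (\<lambda>n. \<integral>\<^sup>+t. ennreal (2 * pi * (cmod (?q n t))\<^sup>2) \<partial>lborel)"
    by (rule nn_integral_liminf) (use q_meas in measurable)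
  also have "\<dots> \<le> (\<integral>\<^sup>+\<omega>. ennreal (\<omega>\<^sup>2 * (cmod (fourier G \<omega>))\<^sup>2) \<partial>lborel)"
    by (intro Liminf_le always_eventually allI q_bound) auto
  finally show ?thesis .
qed

section \<open>The fractional Fourier transform\<close>

lemma has_vector_derivative_iexp:
  assumes "(p has_real_derivative p') (at t)"
  shows "((\<lambda>t. iexp (p t)) has_vector_derivative (\<i> * complex_of_real p' * iexp (p t))) (at t)"
proof -
  have "((\<lambda>t. \<i> * complex_of_real (p t)) has_vector_derivative \<i> * complex_of_real p') (at t)"
    using assms
    by (intro has_vector_derivative_mult_right has_vector_derivative_of_real)
       (simp add: has_real_derivative_iff_has_vector_derivative)
  from field_vector_diff_chain_at[OF this DERIV_exp] show ?thesis
    by (simp add: o_def)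
qed

text \<open>Up to a factor of modulus one, the fractional transform is the Fourier transform of \<open>f\<close> times a
  chirp, read at a rescaled frequency. The extra modulation by \<open>\<nu>\<close> moves the centre \<open>\<nu>\<close> of the
  fractional domain to frequency \<open>0\<close>.\<close>

lemma norm_frft_square:
  fixes f :: "real \<Rightarrow> 'a \<Rightarrow> complex"
  assumes "sin \<alpha> \<noteq> 0"
  shows "(cmod (frft \<alpha> f \<rho> \<eta>))\<^sup>2 = 1 / (2 * pi * \<bar>sin \<alpha>\<bar>) *
    (cmod (fourier (\<lambda>t. f t \<eta> * iexp ((t\<^sup>2 * cos \<alpha> / 2 - \<nu> * t) / sin \<alpha>)) ((\<rho> - \<nu>) / sin \<alpha>)))\<^sup>2"
proof -
  let ?G = "\<lambda>t. f t \<eta> * iexp ((t\<^sup>2 * cos \<alpha> / 2 - \<nu> * t) / sin \<alpha>)"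
  have "(CLINT t|lborel. f t \<eta> * iexp (((t\<^sup>2 + \<rho>\<^sup>2) * cos \<alpha> - 2 * t * \<rho>) / (2 * sin \<alpha>))) =
      (CLINT t|lborel. iexp (\<rho>\<^sup>2 * cos \<alpha> / (2 * sin \<alpha>)) * (?G t * iexp (- ((\<rho> - \<nu>) / sin \<alpha> * t))))"
  proof (intro Bochner_Integration.integral_cong refl)
    fix t
    have "((t\<^sup>2 + \<rho>\<^sup>2) * cos \<alpha> - 2 * t * \<rho>) / (2 * sin \<alpha>) =
        \<rho>\<^sup>2 * cos \<alpha> / (2 * sin \<alpha>) + ((t\<^sup>2 * cos \<alpha> / 2 - \<nu> * t) / sin \<alpha> + - ((\<rho> - \<nu>) / sin \<alpha> * t))"
      using assms by (simp add: field_simps)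
    then show "f t \<eta> * iexp (((t\<^sup>2 + \<rho>\<^sup>2) * cos \<alpha> - 2 * t * \<rho>) / (2 * sin \<alpha>)) =
        iexp (\<rho>\<^sup>2 * cos \<alpha> / (2 * sin \<alpha>)) * (?G t * iexp (- ((\<rho> - \<nu>) / sin \<alpha> * t)))"
      by (simp only: of_real_add distrib_left exp_add) (simp only: mult_ac)
  qed
  also have "\<dots> = iexp (\<rho>\<^sup>2 * cos \<alpha> / (2 * sin \<alpha>)) * fourier ?G ((\<rho> - \<nu>) / sin \<alpha>)"
    unfolding fourier_def by (rule integral_mult_right_zero)
  finally have "cmod (frft \<alpha> f \<rho> \<eta>) =
      1 / cmod (csqrt (\<i> * complex_of_real (2 * pi * sin \<alpha>))) * cmod (fourier ?G ((\<rho> - \<nu>) / sin \<alpha>))"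
    unfolding frft_def by (simp only: norm_mult norm_divide norm_exp_i_times) simp
  moreover have "(cmod (csqrt (\<i> * complex_of_real (2 * pi * sin \<alpha>))))\<^sup>2 = 2 * pi * \<bar>sin \<alpha>\<bar>"
    unfolding norm_power[symmetric] power2_csqrt by (simp add: norm_mult)
  ultimately show ?thesis
    by (simp add: power_mult_distrib power_divide)
qed

text \<open>The left integrand is the squared modulus of \<open>sin \<alpha>\<close> times the derivative of the modulated
  chirped signal \<open>G\<close>. By the previous lemma and a change of variables, the second moment about
  \<open>\<nu>\<close> is \<open>(sin \<alpha>)\<^sup>2 / (2 \<pi>)\<close> times the one of the power spectrum of \<open>G\<close> about \<open>0\<close>. The lower bound thus needs
  only an inequality between a derivative and its spectrum, and it remains meaningful when the right
  side is infinite.\<close>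

lemma frft_second_moment_ge:
  fixes f :: "real \<Rightarrow> 'a \<Rightarrow> complex"
  assumes sin: "sin \<alpha> \<noteq> 0"
    and deriv: "\<And>t. ((\<lambda>t. f t \<eta>) has_vector_derivative f' t) (at t)"
    and f: "integrable lborel (\<lambda>t. f t \<eta>)" "integrable lborel (\<lambda>t. (cmod (f t \<eta>))\<^sup>2)"
  shows "(\<integral>\<^sup>+t. ennreal ((cmod (complex_of_real (sin \<alpha>) * f' t + \<i> * complex_of_real (t * cos \<alpha> - \<nu>) * f t \<eta>))\<^sup>2) \<partial>lborel) \<le>
    (\<integral>\<^sup>+\<rho>. ennreal ((\<rho> - \<nu>)\<^sup>2 * (cmod (frft \<alpha> f \<rho> \<eta>))\<^sup>2) \<partial>lborel)"
proof -
  let ?s = "sin \<alpha>" and ?c = "cos \<alpha>"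
  let ?e = "\<lambda>t. iexp ((t\<^sup>2 * ?c / 2 - \<nu> * t) / ?s)"
  define G where "G t = f t \<eta> * ?e t" for t
  define G' where "G' t = f t \<eta> * (\<i> * complex_of_real ((t * ?c - \<nu>) / ?s) * ?e t) + f' t * ?e t" for t
  have G_deriv: "(G has_vector_derivative G' t) (at t)" for t
    unfolding G_def G'_def
  proof (intro has_vector_derivative_mult deriv has_vector_derivative_iexp)
    show "((\<lambda>t. (t\<^sup>2 * ?c / 2 - \<nu> * t) / ?s) has_real_derivative (t * ?c - \<nu>) / ?s) (at t)"
      using sin by (auto intro!: derivative_eq_intros simp: field_simps)
  qed
  have G_L1: "integrable lborel G"
    unfolding G_def by (rule integrable_mult_iexp[OF f(1)]) simp
  have norm_G: "cmod (G t) = cmod (f t \<eta>)" for t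
    unfolding G_def by (simp only: norm_mult norm_exp_i_times mult_1_right)
  have [measurable]: "fourier G \<in> borel_measurable borel"
    by (rule measurable_fourier) (use G_L1 in auto)
  have "(cmod (?s * f' t + \<i> * complex_of_real (t * ?c - \<nu>) * f t \<eta>))\<^sup>2 = ?s\<^sup>2 / (2 * pi) * (2 * pi * (cmod (G' t))\<^sup>2)" for t
  proof -
    have "(?s * f' t + \<i> * complex_of_real (t * ?c - \<nu>) * f t \<eta>) * ?e t = ?s * G' t"
    proof -
      have "(complex_of_real r * a + \<i> * complex_of_real q * b) * e =
          complex_of_real r * (b * (\<i> * complex_of_real (q / r) * e) + a * e)" if "r \<noteq> 0" for a b e and q r :: real
        using that by (simp add: field_simps)
      from this[OF sin] show ?thesis unfolding G'_def .
    qed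
    then have "cmod (?s * f' t + \<i> * complex_of_real (t * ?c - \<nu>) * f t \<eta>) * cmod (?e t) = \<bar>?s\<bar> * cmod (G' t)"
      by (metis norm_mult norm_of_real)
    then show ?thesis
      by (simp only: norm_exp_i_times) (simp add: power_mult_distrib)
  qed
  then have "(\<integral>\<^sup>+t. ennreal ((cmod (?s * f' t + \<i> * complex_of_real (t * ?c - \<nu>) * f t \<eta>))\<^sup>2) \<partial>lborel) =
      (\<integral>\<^sup>+t. ennreal (?s\<^sup>2 / (2 * pi)) * ennreal (2 * pi * (cmod (G' t))\<^sup>2) \<partial>lborel)"
    by (simp add: ennreal_mult'[symmetric])
  also have "\<dots> = ennreal (?s\<^sup>2 / (2 * pi)) * (\<integral>\<^sup>+t. ennreal (2 * pi * (cmod (G' t))\<^sup>2) \<partial>lborel)"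
  proof (rule nn_integral_cmult)
    have "(\<lambda>t. lim (\<lambda>n. difference_quotient n G t)) \<in> borel_measurable borel"
      unfolding difference_quotient_def using G_L1 by measurable
    also have "(\<lambda>t. lim (\<lambda>n. difference_quotient n G t)) = G'"
      using limI[OF difference_quotient_tendsto[OF G_deriv]] by auto
    finally show "(\<lambda>t. ennreal (2 * pi * (cmod (G' t))\<^sup>2)) \<in> borel_measurable lborel"
      by measurable
  qed
  also have "\<dots> \<le> ennreal (?s\<^sup>2 / (2 * pi)) * (\<integral>\<^sup>+\<omega>. ennreal (\<omega>\<^sup>2 * (cmod (fourier G \<omega>))\<^sup>2) \<partial>lborel)"
    using Plancherel_derivative_le[OF G_deriv G_L1] f(2) norm_G by (intro mult_left_mono) auto
  also have "\<dots> = ennreal \<bar>?s\<bar> * (\<integral>\<^sup>+\<omega>. ennreal (\<bar>?s\<bar> / (2 * pi)) * ennreal (\<omega>\<^sup>2 * (cmod (fourier G \<omega>))\<^sup>2) \<partial>lborel)"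
  proof -
    have "?s\<^sup>2 / (2 * pi) = \<bar>?s\<bar> * (\<bar>?s\<bar> / (2 * pi))"
      by (simp add: power2_eq_square)
    then have "ennreal (?s\<^sup>2 / (2 * pi)) = ennreal \<bar>?s\<bar> * ennreal (\<bar>?s\<bar> / (2 * pi))"
      by (simp only: ennreal_mult'[OF abs_ge_zero])
    moreover have "(\<integral>\<^sup>+\<omega>. ennreal (\<bar>?s\<bar> / (2 * pi)) * ennreal (\<omega>\<^sup>2 * (cmod (fourier G \<omega>))\<^sup>2) \<partial>lborel) =
        ennreal (\<bar>?s\<bar> / (2 * pi)) * (\<integral>\<^sup>+\<omega>. ennreal (\<omega>\<^sup>2 * (cmod (fourier G \<omega>))\<^sup>2) \<partial>lborel)"
      by (rule nn_integral_cmult) measurable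
    ultimately show ?thesis by (simp only: mult.assoc)
  qed
  also have "\<dots> = ennreal \<bar>?s\<bar> * (\<integral>\<^sup>+\<omega>. ennreal (1 / (2 * pi * \<bar>?s\<bar>) * ((?s * \<omega>)\<^sup>2 * (cmod (fourier G \<omega>))\<^sup>2)) \<partial>lborel)"
  proof -
    have "ennreal (\<bar>?s\<bar> / (2 * pi)) * ennreal (\<omega>\<^sup>2 * (cmod (fourier G \<omega>))\<^sup>2) =
      ennreal (1 / (2 * pi * \<bar>?s\<bar>) * ((?s * \<omega>)\<^sup>2 * (cmod (fourier G \<omega>))\<^sup>2))" for \<omega>
    proof -
      have "\<bar>?s\<bar> / (2 * pi) * (\<omega>\<^sup>2 * (cmod (fourier G \<omega>))\<^sup>2) =
          1 / (2 * pi * \<bar>?s\<bar>) * ((?s * \<omega>)\<^sup>2 * (cmod (fourier G \<omega>))\<^sup>2)"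
        using sin by (simp add: field_simps power2_eq_square)
      then show ?thesis by (simp add: ennreal_mult'[symmetric])
    qed
    then show ?thesis by simp
  qed
  also have "\<dots> = (\<integral>\<^sup>+\<rho>. ennreal (1 / (2 * pi * \<bar>?s\<bar>) * ((\<rho> - \<nu>)\<^sup>2 * (cmod (fourier G ((\<rho> - \<nu>) / ?s)))\<^sup>2)) \<partial>lborel)"
  proof -
    have "(\<lambda>\<rho>. ennreal (1 / (2 * pi * \<bar>?s\<bar>) * ((\<rho> - \<nu>)\<^sup>2 * (cmod (fourier G ((\<rho> - \<nu>) / ?s)))\<^sup>2))) \<in> borel_measurable borel"
      by measurable
    from nn_integral_real_affine[OF this sin, of \<nu>] show ?thesis
      using sin by (simp only: add_diff_cancel_left' nonzero_mult_div_cancel_left not_False_eq_True)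
  qed
  also have "\<dots> = (\<integral>\<^sup>+\<rho>. ennreal ((\<rho> - \<nu>)\<^sup>2 * (cmod (frft \<alpha> f \<rho> \<eta>))\<^sup>2) \<partial>lborel)"
    by (intro nn_integral_cong)
       (simp add: norm_frft_square[OF sin, where \<nu>=\<nu>] G_def[abs_def] mult.left_commute)
  finally show ?thesis .
qed

section \<open>Correlation of position and derivative\<close>

text \<open>Integrating \<open>\<phi>' (t + s)\<close> over \<open>s \<in> {0..1}\<close> gives \<open>\<phi> (t + 1) - \<phi> t\<close>, whose integral over
  \<open>t\<close> vanishes by translation invariance; integrating first over \<open>t\<close> gives the integral of
  \<open>\<phi>'\<close>.\<close>

lemma integral_derivative_eq_0:
  fixes \<phi> \<phi>' :: "real \<Rightarrow> real"
  assumes deriv: "\<And>t. (\<phi> has_real_derivative \<phi>' t) (at t)" and cont: "continuous_on UNIV \<phi>'"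
    and \<phi>: "integrable lborel \<phi>" and \<phi>': "integrable lborel \<phi>'"
  shows "(LINT t|lborel. \<phi>' t) = 0"
proof -
  let ?H = "\<lambda>(s, t). \<phi>' (t + s) * indicator {0..1} s"
  have [measurable]: "\<phi>' \<in> borel_measurable borel" using \<phi>' by auto
  have shift: "integrable lborel (\<lambda>t. w (t + s))" "(LINT t|lborel. w (t + s)) = (LINT t|lborel. w t)"
    if "integrable lborel w" for w :: "real \<Rightarrow> real" and s
  proof -
    show "integrable lborel (\<lambda>t. w (t + s))"
      using lborel_integrable_real_affine[OF that, of 1 s] by (simp add: add.commute)
    show "(LINT t|lborel. w (t + s)) = (LINT t|lborel. w t)"
      by (subst (2) lborel_integral_real_affine[where c=1 and t=s]) (auto simp: add.commute)
  qed
  have H: "integrable (lborel \<Otimes>\<^sub>M lborel) ?H"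
  proof (rule lborel_pair.Fubini_integrable)
    show "integrable lborel (\<lambda>s. LINT t|lborel. norm (case (s, t) of (s, t) \<Rightarrow> \<phi>' (t + s) * indicator {0..1} s))"
      using shift(2)[OF integrable_abs[OF \<phi>']] by (simp add: abs_mult)
  qed (use shift(1)[OF \<phi>'] in auto)
  have "(LINT t|lborel. \<phi>' t) = (LINT s|lborel. (LINT t|lborel. \<phi>' t) * indicator {0..1::real} s)"
    unfolding integral_mult_right_zero by (simp add: measure_def)
  also have "\<dots> = (LINT s|lborel. LINT t|lborel. \<phi>' (t + s) * indicator {0..1} s)"
    using shift(2)[OF \<phi>'] by simp
  also have "\<dots> = (LINT t|lborel. LINT s|lborel. \<phi>' (t + s) * indicator {0..1} s)"
    using lborel_pair.Fubini_integral[OF H] by simp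
  also have "\<dots> = (LINT t|lborel. \<phi> (t + 1) - \<phi> t)"
  proof (intro Bochner_Integration.integral_cong refl)
    fix t
    have "(LINT s|lborel. \<phi>' (t + s) * indicator {0..1} s) = \<phi> (t + 1) - \<phi> (t + 0)"
    proof (rule integral_FTC_Icc_real)
      show "((\<lambda>s. \<phi> (t + s)) has_real_derivative \<phi>' (t + s)) (at s)" for s
        using deriv[of "t + s"] by (simp add: DERIV_shift add.commute)
      have "continuous_on UNIV (\<lambda>s. \<phi>' (t + s))"
        by (rule continuous_on_compose2[OF cont]) (auto intro!: continuous_intros)
      then show "isCont (\<lambda>s. \<phi>' (t + s)) s" for s
        by (simp add: continuous_on_eq_continuous_at)
    qed simp
    then show "(LINT s|lborel. \<phi>' (t + s) * indicator {0..1} s) = \<phi> (t + 1) - \<phi> t"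
      by simp
  qed
  also have "\<dots> = 0"
    using shift[OF \<phi>, of 1] \<phi> by simp
  finally show ?thesis .
qed

text \<open>The usual integration by parts behind an uncertainty principle, with
  \<open>\<phi> t = (t - \<mu>) \<bar>f t\<bar>\<^sup>2\<close>: its derivative is
  \<open>\<bar>f t\<bar>\<^sup>2 + 2 (t - \<mu>) Re (cnj (f t) f' t)\<close>, and that has integral \<open>0\<close>.\<close>

lemma position_derivative_correlation_ge:
  fixes f f' :: "real \<Rightarrow> complex"
  assumes deriv: "\<And>t. (f has_vector_derivative f' t) (at t)" and cont: "continuous_on UNIV f'"
    and f: "integrable lborel (\<lambda>t. (cmod (f t))\<^sup>2)"
    and tf: "integrable lborel (\<lambda>t. (cmod (complex_of_real t * f t))\<^sup>2)"
    and f': "integrable lborel (\<lambda>t. (cmod (f' t))\<^sup>2)"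
  shows "ennreal ((LINT t|lborel. (cmod (f t))\<^sup>2) / 2) \<le> (\<integral>\<^sup>+t. ennreal \<bar>(t - \<mu>) * Re (cnj (f t) * f' t)\<bar> \<partial>lborel)"
proof -
  let ?r = "\<lambda>t. Re (cnj (f t) * f' t)"
  have cont_f: "continuous_on UNIV f"
    using deriv by (meson continuous_at_imp_continuous_on has_vector_derivative_continuous)
  have [measurable]: "f \<in> borel_measurable borel" "f' \<in> borel_measurable borel"
    using cont cont_f by (auto intro: borel_measurable_continuous_onI)
  have dom: "integrable lborel (\<lambda>t. 2 * (t\<^sup>2 * (cmod (f t))\<^sup>2) + 2 * \<mu>\<^sup>2 * (cmod (f t))\<^sup>2)"
    using f tf by (simp add: norm_mult power_mult_distrib)
  have sq: "integrable lborel (\<lambda>t. (t - \<mu>)\<^sup>2 * (cmod (f t))\<^sup>2)"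
  proof (rule Bochner_Integration.integrable_bound[OF dom])
    have "(t - \<mu>)\<^sup>2 \<le> 2 * t\<^sup>2 + 2 * \<mu>\<^sup>2" for t
      using zero_le_power2[of "t + \<mu>"] by (simp add: power2_sum power2_diff)
    then have "(t - \<mu>)\<^sup>2 * (cmod (f t))\<^sup>2 \<le> (2 * t\<^sup>2 + 2 * \<mu>\<^sup>2) * (cmod (f t))\<^sup>2" for t
      by (intro mult_right_mono) auto
    then show "AE t in lborel. norm ((t - \<mu>)\<^sup>2 * (cmod (f t))\<^sup>2) \<le> norm (2 * (t\<^sup>2 * (cmod (f t))\<^sup>2) + 2 * \<mu>\<^sup>2 * (cmod (f t))\<^sup>2)"
      by (intro AE_I2) (simp add: algebra_simps)
  qed measurable
  have \<phi>: "integrable lborel (\<lambda>t. (t - \<mu>) * (cmod (f t))\<^sup>2)"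
  proof (rule Bochner_Integration.integrable_bound)
    show "integrable lborel (\<lambda>t. (t - \<mu>)\<^sup>2 * (cmod (f t))\<^sup>2 + (cmod (f t))\<^sup>2)"
      using sq f by simp
    have "norm ((t - \<mu>) * (cmod (f t))\<^sup>2) \<le> norm ((t - \<mu>)\<^sup>2 * (cmod (f t))\<^sup>2 + (cmod (f t))\<^sup>2)" for t
    proof -
      have "\<bar>(t - \<mu>) * (cmod (f t))\<^sup>2\<bar> = \<bar>((t - \<mu>) * cmod (f t)) * cmod (f t)\<bar>"
        by (simp add: power2_eq_square mult.assoc)
      also have "\<dots> \<le> (t - \<mu>)\<^sup>2 * (cmod (f t))\<^sup>2 + (cmod (f t))\<^sup>2"
        using abs_mult_le_sum_squares[of "(t - \<mu>) * cmod (f t)" "cmod (f t)"] by (simp only: power_mult_distrib)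
      finally show ?thesis by simp
    qed
    then show "AE t in lborel. norm ((t - \<mu>) * (cmod (f t))\<^sup>2) \<le> norm ((t - \<mu>)\<^sup>2 * (cmod (f t))\<^sup>2 + (cmod (f t))\<^sup>2)"
      by simp
  qed measurable
  have r: "integrable lborel (\<lambda>t. (t - \<mu>) * ?r t)"
  proof (rule Bochner_Integration.integrable_bound)
    show "integrable lborel (\<lambda>t. (t - \<mu>)\<^sup>2 * (cmod (f t))\<^sup>2 + (cmod (f' t))\<^sup>2)"
      using sq f' by simp
    have "\<bar>(t - \<mu>) * ?r t\<bar> \<le> (t - \<mu>)\<^sup>2 * (cmod (f t))\<^sup>2 + (cmod (f' t))\<^sup>2" for t
    proof -
      have "\<bar>(t - \<mu>) * ?r t\<bar> \<le> \<bar>t - \<mu>\<bar> * (cmod (f t) * cmod (f' t))"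
        using abs_Re_le_cmod[of "cnj (f t) * f' t"] unfolding abs_mult
        by (intro mult_left_mono) (simp_all only: norm_mult complex_mod_cnj abs_ge_zero)
      also have "\<dots> = \<bar>((t - \<mu>) * cmod (f t)) * cmod (f' t)\<bar>"
        by (simp add: abs_mult)
      also have "\<dots> \<le> (t - \<mu>)\<^sup>2 * (cmod (f t))\<^sup>2 + (cmod (f' t))\<^sup>2"
        using abs_mult_le_sum_squares[of "(t - \<mu>) * cmod (f t)" "cmod (f' t)"] by (simp only: power_mult_distrib)
      finally show ?thesis .
    qed
    then show "AE t in lborel. norm ((t - \<mu>) * ?r t) \<le> norm ((t - \<mu>)\<^sup>2 * (cmod (f t))\<^sup>2 + (cmod (f' t))\<^sup>2)"
      by (intro AE_I2) (simp only: real_norm_def, smt (verit))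
  qed measurable
  have "(LINT t|lborel. (cmod (f t))\<^sup>2 + 2 * ((t - \<mu>) * ?r t)) = 0"
  proof (rule integral_derivative_eq_0)
    show "((\<lambda>t. (t - \<mu>) * (cmod (f t))\<^sup>2) has_real_derivative (cmod (f t))\<^sup>2 + 2 * ((t - \<mu>) * ?r t)) (at t)" for t
    proof -
      have "((\<lambda>t. Re (f t)) has_real_derivative Re (f' t)) (at t)" "((\<lambda>t. Im (f t)) has_real_derivative Im (f' t)) (at t)"
        unfolding has_real_derivative_iff_has_vector_derivative
        by (intro bounded_linear.has_vector_derivative[OF bounded_linear_Re] bounded_linear.has_vector_derivative[OF bounded_linear_Im] deriv)+
      moreover have "((\<lambda>t. (t - \<mu>) * ((a t)\<^sup>2 + (b t)\<^sup>2)) has_real_derivative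
          (a t)\<^sup>2 + (b t)\<^sup>2 + 2 * ((t - \<mu>) * (a t * a' + b t * b'))) (at t)"
        if "(a has_real_derivative a') (at t)" "(b has_real_derivative b') (at t)" for a b :: "real \<Rightarrow> real" and a' b'
        using that by (auto intro!: derivative_eq_intros simp: algebra_simps)
      ultimately show ?thesis unfolding cmod_power2 by simp
    qed
    show "continuous_on UNIV (\<lambda>t. (cmod (f t))\<^sup>2 + 2 * ((t - \<mu>) * ?r t))"
      by (intro continuous_intros cont cont_f)
  qed (use \<phi> r f in \<open>simp_all del: complex_cnj_mult Re_complex_of_real times_complex.sel\<close>)
  also have "(LINT t|lborel. (cmod (f t))\<^sup>2 + 2 * ((t - \<mu>) * ?r t)) =
      (LINT t|lborel. (cmod (f t))\<^sup>2) + 2 * (LINT t|lborel. (t - \<mu>) * ?r t)"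
    using r f by (simp del: times_complex.sel)
  finally have "(LINT t|lborel. (cmod (f t))\<^sup>2) / 2 \<le> \<bar>LINT t|lborel. (t - \<mu>) * ?r t\<bar>"
    by linarith
  also have "\<dots> \<le> (LINT t|lborel. \<bar>(t - \<mu>) * ?r t\<bar>)"
    by (rule integral_abs_bound)
  finally have "ennreal ((LINT t|lborel. (cmod (f t))\<^sup>2) / 2) \<le> ennreal (LINT t|lborel. \<bar>(t - \<mu>) * ?r t\<bar>)"
    by (rule ennreal_leI)
  also have "\<dots> = (\<integral>\<^sup>+t. ennreal \<bar>(t - \<mu>) * ?r t\<bar> \<partial>lborel)"
    by (rule nn_integral_eq_integral[symmetric]) (use r in auto)
  finally show ?thesis .
qed

section \<open>Signals in polar form\<close>

text \<open>Pointwise, \<open>\<bar>f t\<bar> \<le> 1 / (1 + t\<^sup>2) + (1 + t\<^sup>2) \<bar>f t\<bar>\<^sup>2\<close>, and both summands are integrable.\<close>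

lemma integrable_of_square_integrable_weighted:
  fixes f :: "real \<Rightarrow> complex"
  assumes [measurable]: "f \<in> borel_measurable borel"
    and f: "integrable lborel (\<lambda>t. (cmod (f t))\<^sup>2)" "integrable lborel (\<lambda>t. (cmod (complex_of_real t * f t))\<^sup>2)"
  shows "integrable lborel f"
proof (rule Bochner_Integration.integrable_bound)
  have "integrable lborel (\<lambda>t::real. inverse (1 + t\<^sup>2))"
    using integrable_inverse_1_plus_square by (simp add: set_integrable_def)
  then show "integrable lborel (\<lambda>t. inverse (1 + t\<^sup>2) + ((cmod (f t))\<^sup>2 + (cmod (complex_of_real t * f t))\<^sup>2))"
    using f by simp
  have "norm (f t) \<le> norm (inverse (1 + t\<^sup>2) + ((cmod (f t))\<^sup>2 + (cmod (complex_of_real t * f t))\<^sup>2))" for t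
  proof -
    let ?w = "sqrt (1 + t\<^sup>2)"
    have w: "?w > 0" "?w\<^sup>2 = 1 + t\<^sup>2" by (simp_all add: add_pos_nonneg)
    have "cmod (f t) = \<bar>inverse ?w * (?w * cmod (f t))\<bar>"
      using w(1) by simp
    also have "\<dots> \<le> (inverse ?w)\<^sup>2 + (?w * cmod (f t))\<^sup>2"
      by (rule abs_mult_le_sum_squares)
    also have "\<dots> = inverse (1 + t\<^sup>2) + ((cmod (f t))\<^sup>2 + (cmod (complex_of_real t * f t))\<^sup>2)"
      unfolding power_mult_distrib power_inverse w(2) by (simp add: norm_mult power_mult_distrib algebra_simps)
    finally show ?thesis by simp
  qed
  then show "AE t in lborel. norm (f t) \<le> norm (inverse (1 + t\<^sup>2) + ((cmod (f t))\<^sup>2 + (cmod (complex_of_real t * f t))\<^sup>2))"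
    by simp
qed measurable

text \<open>The phase gradient enters only through \<open>\<psi>\<^sup>2 deriv \<theta> = Im (cnj f f')\<close>. The right side depends
  on \<open>f\<close> alone, so for almost every outcome the phase term agrees with a jointly measurable function
  even when \<open>\<theta>\<close> itself is not measurable.\<close>

lemma polar_signal_derivative:
  fixes f :: "real \<Rightarrow> complex" and \<psi> \<theta> :: "real \<Rightarrow> real"
  assumes polar: "\<And>t. f t = complex_of_real (\<psi> t) * iexp (\<theta> t)"
    and C1: "\<psi> C1_differentiable_on UNIV" "\<theta> C1_differentiable_on UNIV"
  shows "(f has_vector_derivative vector_derivative f (at t)) (at t)"
    and "continuous_on UNIV (\<lambda>t. vector_derivative f (at t))"
    and "Im (cnj (f t) * vector_derivative f (at t)) = (\<psi> t)\<^sup>2 * deriv \<theta> t"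
proof -
  obtain \<psi>' where \<psi>': "\<And>t. (\<psi> has_vector_derivative \<psi>' t) (at t)" "continuous_on UNIV \<psi>'"
    using C1(1) unfolding C1_differentiable_on_def by auto
  obtain \<theta>' where \<theta>': "\<And>t. (\<theta> has_vector_derivative \<theta>' t) (at t)" "continuous_on UNIV \<theta>'"
    using C1(2) unfolding C1_differentiable_on_def by auto
  define f' where "f' t = complex_of_real (\<psi> t) * (\<i> * complex_of_real (\<theta>' t) * iexp (\<theta> t)) + complex_of_real (\<psi>' t) * iexp (\<theta> t)" for t
  have f': "(f has_vector_derivative f' t) (at t)" for t
    unfolding f'_def polar[abs_def] using \<psi>'(1) \<theta>'(1)
    by (intro has_vector_derivative_mult has_vector_derivative_of_real has_vector_derivative_iexp)
       (simp_all add: has_real_derivative_iff_has_vector_derivative)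
  then have vd: "(\<lambda>t. vector_derivative f (at t)) = f'"
    by (intro ext vector_derivative_at)
  show "(f has_vector_derivative vector_derivative f (at t)) (at t)"
    using f' vd by metis
  have "continuous_on UNIV \<psi>" "continuous_on UNIV \<theta>"
    using \<psi>'(1) \<theta>'(1) by (meson continuous_at_imp_continuous_on has_vector_derivative_continuous)+
  then show "continuous_on UNIV (\<lambda>t. vector_derivative f (at t))"
    unfolding vd f'_def[abs_def] by (intro continuous_intros \<psi>'(2) \<theta>'(2))
  have "deriv \<theta> t = \<theta>' t"
    using \<theta>'(1) by (simp add: DERIV_imp_deriv has_real_derivative_iff_has_vector_derivative)
  moreover have "cnj (f t) * f' t = complex_of_real (\<psi> t * \<psi>' t) + \<i> * complex_of_real ((\<psi> t)\<^sup>2 * \<theta>' t)"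
  proof -
    have "cnj (iexp (\<theta> t)) * iexp (\<theta> t) = 1"
      by (simp add: exp_cnj exp_add[symmetric])
    moreover have "cnj (f t) * f' t = (cnj (iexp (\<theta> t)) * iexp (\<theta> t)) *
        (complex_of_real (\<psi> t * \<psi>' t) + \<i> * complex_of_real ((\<psi> t)\<^sup>2 * \<theta>' t))"
      unfolding polar f'_def by (simp add: algebra_simps power2_eq_square)
    ultimately show ?thesis by simp
  qed
  ultimately show "Im (cnj (f t) * vector_derivative f (at t)) = (\<psi> t)\<^sup>2 * deriv \<theta> t"
    using fun_cong[OF vd, of t] by simp
qed

text \<open>Dividing \<open>cnj f h\<close> by \<open>\<bar>f\<bar>\<close> leaves a function \<open>k\<close> with \<open>\<bar>k\<bar> \<le> \<bar>h\<bar>\<close>. Cauchy--Schwarz applied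
  separately to \<open>Re k\<close> and \<open>Im k\<close>, both against \<open>a \<bar>f\<bar>\<close>, gives two bounds that add up without
  loss because \<open>(Re k)\<^sup>2 + (Im k)\<^sup>2 = \<bar>k\<bar>\<^sup>2\<close>. With absolute values inside both integrals this is
  stronger than Cauchy--Schwarz for the complex integral.\<close>

lemma Cauchy_Schwarz_Re_Im:
  fixes f h :: "'b \<Rightarrow> complex" and a :: "'b \<Rightarrow> real"
  assumes [measurable]: "f \<in> borel_measurable P" "h \<in> borel_measurable P" "a \<in> borel_measurable P"
  shows "(\<integral>\<^sup>+x. ennreal \<bar>a x * Re (cnj (f x) * h x)\<bar> \<partial>P)\<^sup>2 + (\<integral>\<^sup>+x. ennreal \<bar>a x * Im (cnj (f x) * h x)\<bar> \<partial>P)\<^sup>2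
    \<le> (\<integral>\<^sup>+x. ennreal ((a x)\<^sup>2 * (cmod (f x))\<^sup>2) \<partial>P) * (\<integral>\<^sup>+x. ennreal ((cmod (h x))\<^sup>2) \<partial>P)"
proof -
  have [measurable]: "(sgn :: complex \<Rightarrow> complex) \<in> borel_measurable borel"
    unfolding sgn_div_norm[abs_def] by measurable
  define k where "k x = cnj (sgn (f x)) * h x" for x
  have [measurable]: "k \<in> borel_measurable P" unfolding k_def by measurable
  have k: "cnj (f x) * h x = complex_of_real (cmod (f x)) * k x" for x
    unfolding k_def by (cases "f x = 0") (simp_all add: sgn_div_norm scaleR_conv_of_real)
  let ?A = "\<integral>\<^sup>+x. ennreal ((a x)\<^sup>2 * (cmod (f x))\<^sup>2) \<partial>P"
  have CS: "(\<integral>\<^sup>+x. ennreal \<bar>a x * (cmod (f x) * q x)\<bar> \<partial>P)\<^sup>2 \<le> ?A * (\<integral>\<^sup>+x. ennreal ((q x)\<^sup>2) \<partial>P)"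
    if [measurable]: "q \<in> borel_measurable P" for q :: "'b \<Rightarrow> real"
  proof -
    have "(\<integral>\<^sup>+x. ennreal (\<bar>a x\<bar> * cmod (f x)) * ennreal \<bar>q x\<bar> \<partial>P)\<^sup>2 \<le>
        (\<integral>\<^sup>+x. (ennreal (\<bar>a x\<bar> * cmod (f x)))\<^sup>2 \<partial>P) * (\<integral>\<^sup>+x. (ennreal \<bar>q x\<bar>)\<^sup>2 \<partial>P)"
      by (rule Cauchy_Schwarz_nn_integral) measurable
    then show ?thesis
      by (simp add: ennreal_mult[symmetric] ennreal_power abs_mult power_mult_distrib mult.assoc)
  qed
  have "(\<integral>\<^sup>+x. ennreal \<bar>a x * Re (cnj (f x) * h x)\<bar> \<partial>P)\<^sup>2 + (\<integral>\<^sup>+x. ennreal \<bar>a x * Im (cnj (f x) * h x)\<bar> \<partial>P)\<^sup>2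
      \<le> ?A * (\<integral>\<^sup>+x. ennreal ((Re (k x))\<^sup>2) \<partial>P) + ?A * (\<integral>\<^sup>+x. ennreal ((Im (k x))\<^sup>2) \<partial>P)"
    using add_mono[OF CS[of "\<lambda>x. Re (k x)"] CS[of "\<lambda>x. Im (k x)"]] unfolding k by simp
  also have "\<dots> = ?A * (\<integral>\<^sup>+x. ennreal ((cmod (k x))\<^sup>2) \<partial>P)"
    by (simp add: distrib_left[symmetric] nn_integral_add[symmetric] cmod_power2)
  also have "\<dots> \<le> ?A * (\<integral>\<^sup>+x. ennreal ((cmod (h x))\<^sup>2) \<partial>P)"
    by (intro mult_left_mono nn_integral_mono ennreal_leI power_mono)
       (auto simp: k_def norm_mult norm_sgn)
  finally show ?thesis .
qed

section \<open>The uncertainty inequality\<close>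

theorem corollary2:
  fixes M :: "'a measure"
    and f :: "real \<Rightarrow> 'a \<Rightarrow> complex"
    and \<psi> \<theta> :: "real \<Rightarrow> 'a \<Rightarrow> real"
    and \<alpha> :: real
  assumes "prob_space M"
    and polar: "\<And>t \<eta>. \<eta> \<in> space M \<Longrightarrow>
          f t \<eta> = complex_of_real (\<psi> t \<eta>) * exp (\<i> * complex_of_real (\<theta> t \<eta>))"
    and "square_integrable (lborel \<Otimes>\<^sub>M M) (\<lambda>(t, \<eta>). f t \<eta>)"
    and "signal_norm M f = 1"
    and "AE \<eta> in M. square_integrable lborel (\<lambda>t. f t \<eta>)"
    and "AE \<eta> in M. square_integrable lborel (\<lambda>t. complex_of_real t * f t \<eta>)"
    and "AE \<eta> in M. square_integrable lborel (\<lambda>t. vector_derivative (\<lambda>s. f s \<eta>) (at t))"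
    and "AE \<eta> in M. (\<lambda>t. \<psi> t \<eta>) C1_differentiable_on UNIV"
    and "AE \<eta> in M. (\<lambda>t. \<theta> t \<eta>) C1_differentiable_on UNIV"
    and "AE \<eta> in M. ((\<lambda>t. f t \<eta>) \<longlongrightarrow> 0) at_infinity"
    and "sin \<alpha> \<noteq> 0"
    and "has_mean M f"
    and "has_mean M (frft \<alpha> f)"
  shows "expected_spread M f * expected_spread M (frft \<alpha> f) \<ge>
           ennreal ((sin \<alpha>)\<^sup>2 / 4) +
           (\<integral>\<^sup>+\<eta>. (\<integral>\<^sup>+t. ennreal
              (\<bar>(t - signal_mean M f) *
                (t * cos \<alpha> + sin \<alpha> * deriv (\<lambda>s. \<theta> s \<eta>) t - signal_mean M (frft \<alpha> f))\<bar>
               * (\<psi> t \<eta>)\<^sup>2) \<partial>lborel) \<partial>M)\<^sup>2"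
proof -
  interpret prob_space M by fact
  interpret LM: pair_sigma_finite lborel M ..
  let ?P = "lborel \<Otimes>\<^sub>M M" and ?s = "sin \<alpha>" and ?c = "cos \<alpha>" and ?f = "case_prod f"
  define \<mu> where "\<mu> = signal_mean M f"
  define \<nu> where "\<nu> = signal_mean M (frft \<alpha> f)"
  \<comment> \<open>A limit of difference quotients agrees with the derivative for almost every \<open>\<eta>\<close>, and it is
    measurable on the product space whether or not it is a derivative elsewhere.\<close>
  define D where "D t \<eta> = lim (\<lambda>n. difference_quotient n (\<lambda>s. f s \<eta>) t)" for t \<eta>
  \<comment> \<open>The function of \<open>t\<close> whose energy bounds the second moment of the transform from below.\<close>
  define h where "h t \<eta> = ?s * D t \<eta> + \<i> * complex_of_real (t * ?c - \<nu>) * f t \<eta>" for t \<eta>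
  let ?h = "case_prod h"
  have f_meas [measurable]: "(\<lambda>(t, \<eta>). f t \<eta>) \<in> borel_measurable ?P"
    and f_int: "integrable ?P (\<lambda>(t, \<eta>). (cmod (f t \<eta>))\<^sup>2)"
    using assms(3) by (auto simp: square_integrable_def split_beta')
  have [measurable]: "(\<lambda>(t, \<eta>). D t \<eta>) \<in> borel_measurable ?P"
    unfolding D_def difference_quotient_def by measurable
  have [measurable]: "(\<lambda>(t, \<eta>). h t \<eta>) \<in> borel_measurable ?P"
    unfolding h_def by measurable

  have regular: "AE \<eta> in M.
     (\<forall>t. ((\<lambda>t. f t \<eta>) has_vector_derivative D t \<eta>) (at t)) \<and> continuous_on UNIV (\<lambda>t. D t \<eta>) \<and>
     (\<forall>t. Im (cnj (f t \<eta>) * D t \<eta>) = (\<psi> t \<eta>)\<^sup>2 * deriv (\<lambda>s. \<theta> s \<eta>) t) \<and>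
     integrable lborel (\<lambda>t. f t \<eta>) \<and> integrable lborel (\<lambda>t. (cmod (f t \<eta>))\<^sup>2) \<and>
     integrable lborel (\<lambda>t. (cmod (complex_of_real t * f t \<eta>))\<^sup>2) \<and> integrable lborel (\<lambda>t. (cmod (D t \<eta>))\<^sup>2)"
    using assms(5-9) AE_space
  proof eventually_elim
    case (elim \<eta>)
    note pd = polar_signal_derivative[OF polar[OF \<open>\<eta> \<in> space M\<close>] elim(4,5)]
    have D: "D t \<eta> = vector_derivative (\<lambda>s. f s \<eta>) (at t)" for t
      unfolding D_def by (rule limI[OF difference_quotient_tendsto[OF pd(1)]])
    have meas: "(\<lambda>t. f t \<eta>) \<in> borel_measurable borel"
      and L2: "integrable lborel (\<lambda>t. (cmod (f t \<eta>))\<^sup>2)"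
        "integrable lborel (\<lambda>t. (cmod (complex_of_real t * f t \<eta>))\<^sup>2)"
        "integrable lborel (\<lambda>t. (cmod (vector_derivative (\<lambda>s. f s \<eta>) (at t)))\<^sup>2)"
      using elim(1-3) unfolding square_integrable_def by simp_all
    show ?case
      unfolding D
      by (intro conjI allI pd L2 integrable_of_square_integrable_weighted[OF meas L2(1,2)])
  qed

  have A: "expected_spread M f = (\<integral>\<^sup>+p. ennreal ((fst p - \<mu>)\<^sup>2 * (cmod (?f p))\<^sup>2) \<partial>?P)"
    unfolding expected_spread_def \<mu>_def[symmetric]
    by (subst LM.nn_integral_snd[symmetric]) auto
  have B: "(\<integral>\<^sup>+p. ennreal ((cmod (?h p))\<^sup>2) \<partial>?P) \<le> expected_spread M (frft \<alpha> f)"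
  proof -
    have "(\<integral>\<^sup>+p. ennreal ((cmod (?h p))\<^sup>2) \<partial>?P) =
        (\<integral>\<^sup>+\<eta>. \<integral>\<^sup>+t. ennreal ((cmod (h t \<eta>))\<^sup>2) \<partial>lborel \<partial>M)"
      by (subst LM.nn_integral_snd[symmetric]) auto
    also have "\<dots> \<le> expected_spread M (frft \<alpha> f)"
      unfolding expected_spread_def \<nu>_def[symmetric]
    proof (rule nn_integral_mono_AE)
      show "AE \<eta> in M. (\<integral>\<^sup>+t. ennreal ((cmod (h t \<eta>))\<^sup>2) \<partial>lborel) \<le>
          (\<integral>\<^sup>+\<rho>. ennreal ((\<rho> - \<nu>)\<^sup>2 * (cmod (frft \<alpha> f \<rho> \<eta>))\<^sup>2) \<partial>lborel)"
        using regular
      proof eventually_elim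
        case (elim \<eta>)
        then show ?case
          unfolding h_def by (intro frft_second_moment_ge assms(11)) auto
      qed
    qed
    finally show ?thesis .
  qed
  have norm: "(\<integral>\<^sup>+\<eta>. \<integral>\<^sup>+t. ennreal ((cmod (f t \<eta>))\<^sup>2) \<partial>lborel \<partial>M) = 1"
  proof -
    have "(\<integral>\<^sup>+\<eta>. \<integral>\<^sup>+t. ennreal ((cmod (f t \<eta>))\<^sup>2) \<partial>lborel \<partial>M) =
        (\<integral>\<^sup>+p. ennreal (case p of (t, \<eta>) \<Rightarrow> (cmod (f t \<eta>))\<^sup>2) \<partial>?P)"
      by (subst LM.nn_integral_snd[symmetric]) auto
    also have "\<dots> = ennreal (integral\<^sup>L ?P (\<lambda>(t, \<eta>). (cmod (f t \<eta>))\<^sup>2))"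
      by (rule nn_integral_eq_integral[OF f_int]) auto
    also have "integral\<^sup>L ?P (\<lambda>(t, \<eta>). (cmod (f t \<eta>))\<^sup>2) = (\<integral>\<eta>. (\<integral>t. (cmod (f t \<eta>))\<^sup>2 \<partial>lborel) \<partial>M)"
      by (rule LM.integral_snd[OF f_int, symmetric])
    also have "\<dots> = 1"
      using assms(4) by (simp add: signal_norm_def)
    finally show ?thesis by simp
  qed
  \<comment> \<open>The amplitude part: the real part keeps \<open>sin \<alpha> Re (cnj f D)\<close> only, which integration by parts
    bounds for each \<open>\<eta>\<close>.\<close>
  have Re: "ennreal (\<bar>?s\<bar> / 2) \<le> (\<integral>\<^sup>+p. ennreal \<bar>(fst p - \<mu>) * Re (cnj (?f p) * ?h p)\<bar> \<partial>?P)"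
  proof -
    have "ennreal (\<bar>?s\<bar> / 2) = ennreal (\<bar>?s\<bar> / 2) * (\<integral>\<^sup>+\<eta>. \<integral>\<^sup>+t. ennreal ((cmod (f t \<eta>))\<^sup>2) \<partial>lborel \<partial>M)"
      using norm by simp
    also have "\<dots> = (\<integral>\<^sup>+\<eta>. ennreal (\<bar>?s\<bar> / 2) * (\<integral>\<^sup>+t. ennreal ((cmod (f t \<eta>))\<^sup>2) \<partial>lborel) \<partial>M)"
      by (rule nn_integral_cmult[symmetric]) measurable
    also have "\<dots> \<le> (\<integral>\<^sup>+\<eta>. \<integral>\<^sup>+t. ennreal \<bar>(t - \<mu>) * Re (cnj (f t \<eta>) * h t \<eta>)\<bar> \<partial>lborel \<partial>M)"
    proof (rule nn_integral_mono_AE)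
      show "AE \<eta> in M. ennreal (\<bar>?s\<bar> / 2) * (\<integral>\<^sup>+t. ennreal ((cmod (f t \<eta>))\<^sup>2) \<partial>lborel) \<le>
          (\<integral>\<^sup>+t. ennreal \<bar>(t - \<mu>) * Re (cnj (f t \<eta>) * h t \<eta>)\<bar> \<partial>lborel)"
        using regular AE_space
      proof eventually_elim
        case (elim \<eta>)
        have [measurable]: "(\<lambda>t. f t \<eta>) \<in> borel_measurable borel" "(\<lambda>t. D t \<eta>) \<in> borel_measurable borel"
          using elim by (auto intro: borel_measurable_continuous_onI)
        have "Re (cnj z * (?s * d + \<i> * complex_of_real r * z)) = ?s * Re (cnj z * d)" for z d :: complex and r
          by (simp add: algebra_simps)
        then have Re_h: "Re (cnj (f t \<eta>) * h t \<eta>) = ?s * Re (cnj (f t \<eta>) * D t \<eta>)" for t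
          unfolding h_def .
        have "ennreal (\<bar>?s\<bar> / 2) * (\<integral>\<^sup>+t. ennreal ((cmod (f t \<eta>))\<^sup>2) \<partial>lborel) =
            ennreal \<bar>?s\<bar> * ennreal ((LINT t|lborel. (cmod (f t \<eta>))\<^sup>2) / 2)"
          using elim by (subst nn_integral_eq_integral) (auto simp: ennreal_mult'[symmetric])
        also have "\<dots> \<le> ennreal \<bar>?s\<bar> * (\<integral>\<^sup>+t. ennreal \<bar>(t - \<mu>) * Re (cnj (f t \<eta>) * D t \<eta>)\<bar> \<partial>lborel)"
          using elim by (intro mult_left_mono position_derivative_correlation_ge) auto
        also have "\<dots> = (\<integral>\<^sup>+t. ennreal \<bar>?s\<bar> * ennreal \<bar>(t - \<mu>) * Re (cnj (f t \<eta>) * D t \<eta>)\<bar> \<partial>lborel)"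
          by (rule nn_integral_cmult[symmetric]) measurable
        also have "\<dots> = (\<integral>\<^sup>+t. ennreal \<bar>(t - \<mu>) * Re (cnj (f t \<eta>) * h t \<eta>)\<bar> \<partial>lborel)"
          unfolding Re_h by (simp only: ennreal_mult'[symmetric] abs_ge_zero abs_mult[symmetric] mult.left_commute)
        finally show ?case .
      qed
    qed
    also have "\<dots> = (\<integral>\<^sup>+p. ennreal \<bar>(fst p - \<mu>) * Re (cnj (?f p) * ?h p)\<bar> \<partial>?P)"
      by (subst LM.nn_integral_snd[symmetric]) auto
    finally show ?thesis .
  qed
  \<comment> \<open>The phase part: the imaginary part of \<open>cnj f h\<close> is exactly the integrand of the covariance term.\<close>
  have Im: "(\<integral>\<^sup>+\<eta>. (\<integral>\<^sup>+t. ennreal (\<bar>(t - \<mu>) * (t * ?c + ?s * deriv (\<lambda>s. \<theta> s \<eta>) t - \<nu>)\<bar> * (\<psi> t \<eta>)\<^sup>2) \<partial>lborel) \<partial>M) =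
      (\<integral>\<^sup>+p. ennreal \<bar>(fst p - \<mu>) * Im (cnj (?f p) * ?h p)\<bar> \<partial>?P)"
  proof -
    have "(\<integral>\<^sup>+\<eta>. (\<integral>\<^sup>+t. ennreal (\<bar>(t - \<mu>) * (t * ?c + ?s * deriv (\<lambda>s. \<theta> s \<eta>) t - \<nu>)\<bar> * (\<psi> t \<eta>)\<^sup>2) \<partial>lborel) \<partial>M) =
        (\<integral>\<^sup>+\<eta>. \<integral>\<^sup>+t. ennreal \<bar>(t - \<mu>) * Im (cnj (f t \<eta>) * h t \<eta>)\<bar> \<partial>lborel \<partial>M)"
    proof (rule nn_integral_cong_AE)
      show "AE \<eta> in M. (\<integral>\<^sup>+t. ennreal (\<bar>(t - \<mu>) * (t * ?c + ?s * deriv (\<lambda>s. \<theta> s \<eta>) t - \<nu>)\<bar> * (\<psi> t \<eta>)\<^sup>2) \<partial>lborel) =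
          (\<integral>\<^sup>+t. ennreal \<bar>(t - \<mu>) * Im (cnj (f t \<eta>) * h t \<eta>)\<bar> \<partial>lborel)"
        using regular AE_space
      proof eventually_elim
        case (elim \<eta>)
        have gen: "Im (cnj z * (?s * d + \<i> * complex_of_real r * z)) = ?s * Im (cnj z * d) + r * (cmod z)\<^sup>2" for z d :: complex and r
          unfolding cmod_power2 by (simp add: algebra_simps power2_eq_square)
        have norm_f: "cmod (f t \<eta>) = \<bar>\<psi> t \<eta>\<bar>" for t
          unfolding polar[OF \<open>\<eta> \<in> space M\<close>] by (simp add: norm_mult)
        have "Im (cnj (f t \<eta>) * h t \<eta>) = (t * ?c + ?s * deriv (\<lambda>s. \<theta> s \<eta>) t - \<nu>) * (\<psi> t \<eta>)\<^sup>2" for t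
        proof -
          have "Im (cnj (f t \<eta>) * D t \<eta>) = (\<psi> t \<eta>)\<^sup>2 * deriv (\<lambda>s. \<theta> s \<eta>) t"
            using elim by blast
          then show ?thesis
            unfolding h_def gen norm_f by (simp only: power2_abs) (simp add: algebra_simps)
        qed
        then show ?case by (simp only: abs_mult abs_power2 mult.assoc)
      qed
    qed
    also have "\<dots> = (\<integral>\<^sup>+p. ennreal \<bar>(fst p - \<mu>) * Im (cnj (?f p) * ?h p)\<bar> \<partial>?P)"
      by (subst LM.nn_integral_snd[symmetric]) auto
    finally show ?thesis .
  qed
  have "ennreal (?s\<^sup>2 / 4) + (\<integral>\<^sup>+\<eta>. (\<integral>\<^sup>+t. ennreal (\<bar>(t - \<mu>) * (t * ?c + ?s * deriv (\<lambda>s. \<theta> s \<eta>) t - \<nu>)\<bar> * (\<psi> t \<eta>)\<^sup>2) \<partial>lborel) \<partial>M)\<^sup>2 \<le>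
     (\<integral>\<^sup>+p. ennreal \<bar>(fst p - \<mu>) * Re (cnj (?f p) * ?h p)\<bar> \<partial>?P)\<^sup>2 +
     (\<integral>\<^sup>+p. ennreal \<bar>(fst p - \<mu>) * Im (cnj (?f p) * ?h p)\<bar> \<partial>?P)\<^sup>2"
  proof (unfold Im, rule add_right_mono)
    have "ennreal (?s\<^sup>2 / 4) = (ennreal (\<bar>?s\<bar> / 2))\<^sup>2"
      by (simp add: ennreal_power power_divide)
    also have "\<dots> \<le> (\<integral>\<^sup>+p. ennreal \<bar>(fst p - \<mu>) * Re (cnj (?f p) * ?h p)\<bar> \<partial>?P)\<^sup>2"
      by (rule power_mono[OF Re]) simp
    finally show "ennreal (?s\<^sup>2 / 4) \<le> \<dots>" .
  qed
  also have "\<dots> \<le> expected_spread M f * (\<integral>\<^sup>+p. ennreal ((cmod (?h p))\<^sup>2) \<partial>?P)"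
    unfolding A by (rule Cauchy_Schwarz_Re_Im) measurable
  also have "\<dots> \<le> expected_spread M f * expected_spread M (frft \<alpha> f)"
    by (rule mult_left_mono[OF B]) simp
  finally show ?thesis unfolding \<mu>_def \<nu>_def .
qed

end
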